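(* Let $n\ge1$ be an integer, let $\rho\ge1$, and let $$\mathcal{O}_n=\left\{(\lambda,\alpha)\in\mathbb{R}^2:\ \lambda>-1,\ -\frac{n+2}{2}<\alpha\le\min\left[\lambda,\ \frac14\left(3\lambda-\frac{n+3}{2}+\rho\right),\ \frac12\left(\lambda-\frac{n+1}{2}+\rho\right)\right]\right\}.$$ If $(\lambda,\alpha)\in\mathcal{O}_n$, then the function $$W(\mathbf{x})=\int_0^\infty\left(1-\frac{\|\mathbf{x}\|^2}{t}\right)_+^\lambda t^\alpha\left(1-t^{1/2}\right)_+^\rho\,dt\qquad(\mathbf{x}\in\mathbb{R}^n)$$ has a strictly positive Fourier transform and hence induces positive definite matrices on $\mathbb{R}^n$.
   Context: $\|\cdot\|$ is the Euclidean norm on $\mathbb{R}^n$. For $s\in\mathbb{R}$ and a real exponent $p$, $(s)_+^p=s^p$ if $s>0$ and $(s)_+^p=0$ if $s\le0$. The Fourier transform is $\widehat W(\xi)=\int_{\mathbb{R}^n}W(\mathbf{x})e^{-i\xi\cdot\mathbf{x}}\,d\mathbf{x}$, $\xi\in\mathbb{R}^n$. "Induces positive definite matrices on $\mathbb{R}^n$" means that for every finite set of pairwise distinct points $\mathbf{x}_1,\dots,\mathbf{x}_N\in\mathbb{R}^n$ the matrix $\left(W(\mathbf{x}_i-\mathbf{x}_j)\right)_{i,j=1}^N$ is positive definite.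
   Formalization: For α ≤ −1 one has W(0)=∞, so the matrices are not real; positive definiteness is then understood with diagonal entries +∞, finite off-diagonal entries, and the quadratic form taken in (−∞,∞]; for α > −1 it is the usual notion. *)

theory Defs
  imports "HOL-Analysis.Analysis"
begin

text \<open>For s > 0 this is the real power; unlike \<open>powr\<close>, it vanishes for s < 0 as well.\<close>

definition pos_powr :: "real \<Rightarrow> real \<Rightarrow> real" where
  "pos_powr s p = (if s > 0 then s powr p else 0)"

definition admissible :: "nat \<Rightarrow> real \<Rightarrow> (real \<times> real) set" where
  "admissible n \<rho> = {(l, \<alpha>). l > -1 \<and> - (real n + 2) / 2 < \<alpha> \<and>
     \<alpha> \<le> Min {l, (1/4) * (3 * l - (real n + 3) / 2 + \<rho>), (1/2) * (l - (real n + 1) / 2 + \<rho>)}}"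

text \<open>The integrand is nonnegative, so the integral is taken with values in \<open>[0, \<infinity>]\<close>.
  This matters: for \<open>\<alpha> \<le> -1\<close>, which \<open>admissible\<close> allows, \<open>W 0 = \<infinity>\<close>
  (see \<open>W_zero_eq_top_iff\<close> below).\<close>

definition W :: "real \<Rightarrow> real \<Rightarrow> real \<Rightarrow> 'a::euclidean_space \<Rightarrow> ennreal" where
  "W l \<alpha> \<rho> x = (\<integral>\<^sup>+ t \<in> {0<..}.
     ennreal (pos_powr (1 - (norm x)\<^sup>2 / t) l * t powr \<alpha> * pos_powr (1 - t powr (1/2)) \<rho>) \<partial>lborel)"

text \<open>As a Bochner integral this is \<open>0\<close> when \<open>f\<close> is not integrable; hence a nonzero value
  entails integrability of \<open>f\<close>.\<close>

definition fourier :: "('a::euclidean_space \<Rightarrow> real) \<Rightarrow> 'a \<Rightarrow> complex" where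
  "fourier f \<xi> = (\<integral> x. complex_of_real (f x) * exp (- (\<i> * complex_of_real (\<xi> \<bullet> x))) \<partial>lborel)"

text \<open>Positive definiteness of an \<open>N \<times> N\<close> matrix whose diagonal entries may be \<open>\<infinity>\<close>.
  Off-diagonal entries have to be finite, so the quadratic form is a well-defined element of
  \<open>(-\<infinity>, \<infinity>]\<close> (no \<open>\<infinity> - \<infinity>\<close> occurs, and \<open>0 \<cdot> \<infinity> = 0\<close>). For real matrices
  this is the usual notion, see \<open>positive_definite_real_iff\<close>.\<close>

definition positive_definite :: "nat \<Rightarrow> (nat \<Rightarrow> nat \<Rightarrow> ereal) \<Rightarrow> bool" where
  "positive_definite N A \<longleftrightarrow>
     (\<forall>i<N. \<forall>j<N. A i j = A j i) \<and>
     (\<forall>i<N. \<forall>j<N. A i j \<noteq> -\<infinity> \<and> (i \<noteq> j \<longrightarrow> A i j \<noteq> \<infinity>)) \<and>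
     (\<forall>c :: nat \<Rightarrow> real. (\<exists>i<N. c i \<noteq> 0) \<longrightarrow>
        0 < (\<Sum>i<N. \<Sum>j<N. ereal (c i * c j) * A i j))"

definition induces_positive_definite :: "('a::euclidean_space \<Rightarrow> ennreal) \<Rightarrow> bool" where
  "induces_positive_definite f \<longleftrightarrow>
     (\<forall>N (x :: nat \<Rightarrow> 'a). inj_on x {..<N} \<longrightarrow>
        positive_definite N (\<lambda>i j. enn2ereal (f (x i - x j))))"

lemma positive_definite_real_iff:
  fixes A :: "nat \<Rightarrow> nat \<Rightarrow> real"
  shows "positive_definite N (\<lambda>i j. ereal (A i j)) \<longleftrightarrow>
    (\<forall>i<N. \<forall>j<N. A i j = A j i) \<and>
    (\<forall>c. (\<exists>i<N. c i \<noteq> 0) \<longrightarrow> 0 < (\<Sum>i<N. \<Sum>j<N. c i * c j * A i j))"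
  by (simp add: positive_definite_def)

lemma W_zero:
  "W l \<alpha> \<rho> (0 :: 'a::euclidean_space) =
     (\<integral>\<^sup>+ t \<in> {0<..}. ennreal (t powr \<alpha> * pos_powr (1 - t powr (1/2)) \<rho>) \<partial>lborel)"
  by (simp add: W_def pos_powr_def)

lemma W_zero_finite:
  assumes "\<alpha> > -1" and "\<rho> \<ge> 0"
  shows "W l \<alpha> \<rho> (0 :: 'a::euclidean_space) < \<infinity>"
proof -
  have "(\<lambda>t::real. t powr \<alpha>) integrable_on {0<..1}"
    using assms integrable_on_powr_from_0'[of \<alpha> 1] by simp
  then obtain r where r: "((\<lambda>t::real. t powr \<alpha>) has_integral r) {0<..1}"
    by (auto simp: integrable_on_def)
  have "W l \<alpha> \<rho> (0 :: 'a) \<le> (\<integral>\<^sup>+ t \<in> {0<..1}. ennreal (t powr \<alpha>) \<partial>lborel)"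
    unfolding W_zero
  proof (rule nn_integral_mono)
    fix t :: real
    have "pos_powr (1 - t powr (1/2)) \<rho> \<le> 1"
      using assms powr_mono2[of \<rho> "1 - t powr (1/2)" 1] by (auto simp: pos_powr_def)
    then have "t powr \<alpha> * pos_powr (1 - t powr (1/2)) \<rho> \<le> t powr \<alpha>"
      by (simp add: mult_left_le)
    moreover have "pos_powr (1 - t powr (1/2)) \<rho> = 0" if "t > 1"
      using that by (simp add: pos_powr_def not_less ge_one_powr_ge_zero)
    ultimately show "ennreal (t powr \<alpha> * pos_powr (1 - t powr (1/2)) \<rho>) * indicator {0<..} t
        \<le> ennreal (t powr \<alpha>) * indicator {0<..1} t"
      by (cases "t > 1") (auto simp: indicator_def intro: ennreal_leI)
  qed
  also have "\<dots> = ennreal r"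
    using nn_integral_has_integral_lebesgue[OF _ r] by (simp add: nn_integral_completion mult.commute ennreal_mult' flip: ennreal_indicator)
  finally show ?thesis by (simp add: order.strict_trans1)
qed

lemma W_zero_infinite:
  assumes "\<alpha> \<le> -1" and "\<rho> \<ge> 0"
  shows "W l \<alpha> \<rho> (0 :: 'a::euclidean_space) = \<infinity>"
proof -
  have key: "ennreal (2 powr (-\<rho>) * (ln (1/4) - ln e)) \<le> W l \<alpha> \<rho> (0 :: 'a)"
    if e: "0 < e" "e < 1/4" for e
  proof -
    have "(\<integral>\<^sup>+ t \<in> {e..1/4}. ennreal (2 powr (-\<rho>) * (1 / t)) \<partial>lborel) =
        ennreal (2 powr (-\<rho>) * ln (1/4) - 2 powr (-\<rho>) * ln e)"
      by (rule nn_integral_FTC_Icc)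
        (use e in \<open>auto intro!: derivative_eq_intros simp: field_simps\<close>)
    moreover have "(\<integral>\<^sup>+ t \<in> {e..1/4}. ennreal (2 powr (-\<rho>) * (1 / t)) \<partial>lborel) \<le> W l \<alpha> \<rho> (0 :: 'a)"
      unfolding W_zero
    proof (rule nn_integral_mono)
      fix t :: real
      show "ennreal (2 powr (-\<rho>) * (1 / t)) * indicator {e..1/4} t
          \<le> ennreal (t powr \<alpha> * pos_powr (1 - t powr (1/2)) \<rho>) * indicator {0<..} t"
      proof (cases "t \<in> {e..1/4}")
        case True
        then have t: "0 < t" "t \<le> 1/4" using e by auto
        have "sqrt t \<le> sqrt (1/4)" using t by (intro real_sqrt_le_mono) auto
        then have s: "1 - t powr (1/2) \<ge> 1/2" using t by (simp add: powr_half_sqrt real_sqrt_divide)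
        have "2 powr (-\<rho>) = (1/2) powr \<rho>" by (simp add: powr_minus_divide powr_divide)
        also have "\<dots> \<le> pos_powr (1 - t powr (1/2)) \<rho>"
          using s assms powr_mono2[of \<rho> "1/2" "1 - t powr (1/2)"] by (auto simp: pos_powr_def)
        finally have 1: "2 powr (-\<rho>) \<le> pos_powr (1 - t powr (1/2)) \<rho>" .
        have "1 / t = t powr (-1)" using t by (simp add: powr_minus_divide)
        also have "\<dots> \<le> t powr \<alpha>" using t assms by (intro powr_mono') auto
        finally have 2: "1 / t \<le> t powr \<alpha>" .
        have "2 powr (-\<rho>) * (1 / t) \<le> pos_powr (1 - t powr (1/2)) \<rho> * t powr \<alpha>"
          using 1 2 t by (intro mult_mono) (auto simp: pos_powr_def)
        then show ?thesis using True t by (simp add: mult.commute ennreal_leI)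
      qed simp
    qed
    ultimately show ?thesis by (simp add: right_diff_distrib)
  qed
  have "ennreal (real n) \<le> W l \<alpha> \<rho> (0 :: 'a)" if "n > 0" for n :: nat
  proof -
    define e where "e = exp (ln (1/4) - 2 powr \<rho> * real n)"
    have "e < exp (ln (1/4))" unfolding e_def using that by (subst exp_less_cancel_iff) simp
    then have "ennreal (2 powr (-\<rho>) * (ln (1/4) - ln e)) \<le> W l \<alpha> \<rho> (0 :: 'a)"
      by (intro key) (auto simp: e_def)
    moreover have "2 powr (-\<rho>) * (ln (1/4) - ln e) = real n"
      by (simp add: e_def powr_minus)
    ultimately show ?thesis by simp
  qed
  then have *: "of_nat n \<le> W l \<alpha> \<rho> (0 :: 'a)" for n :: nat
    by (cases "n = 0") (auto simp: ennreal_of_nat_eq_real_of_nat)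
  show ?thesis
  proof (rule ccontr)
    assume "W l \<alpha> \<rho> (0 :: 'a) \<noteq> \<infinity>"
    then obtain n :: nat where "W l \<alpha> \<rho> (0 :: 'a) < of_nat n"
      using ennreal_Ex_less_of_nat[of "W l \<alpha> \<rho> (0 :: 'a)"] by (auto simp: less_top)
    with *[of n] show False by simp
  qed
qed

lemma W_zero_eq_top_iff:
  "\<rho> \<ge> 0 \<Longrightarrow> W l \<alpha> \<rho> (0 :: 'a::euclidean_space) = \<infinity> \<longleftrightarrow> \<alpha> \<le> -1"
  using W_zero_finite[of \<alpha> \<rho> l] W_zero_infinite[of \<alpha> \<rho> l]
  by (metis less_irrefl not_le_imp_less)

end

theory Submission
  imports Defs "HOL-Probability.Distributions" "HOL-Real_Asymp.Real_Asymp"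
begin

text \<open>With \<open>m = 2\<alpha> + n + 1\<close> and \<open>\<nu> = l + n/2\<close>, the Fourier transform of \<open>W\<close> at \<open>\<xi>\<close> is a positive
  multiple of \<open>\<integral>\<^sub>0\<^sup>1 u\<^sup>m (1 - u)\<^sup>\<rho> (ur)\<^sup>-\<^sup>\<nu> J\<^sub>\<nu>(ur) du\<close> with \<open>r = \<parallel>\<xi>\<parallel>\<close>, an entire function of
  \<open>y = r\<^sup>2\<close> whose coefficients are quotients of Gamma functions. Comparing them with the coefficients of
  \<open>J\<^sub>\<sigma>(r/2)\<^sup>2 / r\<^sup>2\<^sup>\<sigma> \<ge> 0\<close> for a suitable \<open>\<sigma>\<close>, the admissibility conditions guarantee that the
  Gamma parameters in the numerator of the ratio (weakly) majorize those in the denominator. By the product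
  formula for \<open>\<Gamma>\<close> such a ratio is a limit of products of factors \<open>1 + C / ((a + k) (b + k))\<close> and
  \<open>1 + C / (a + k)\<close> with \<open>C \<ge> 0\<close>. Multiplying the \<open>k\<close>-th coefficient by \<open>1 / (a + k)\<close> averages a
  function over \<open>[0, y]\<close> and so preserves positivity; hence the ratio does, too.

  For positive definiteness, \<open>W\<close> is decreasing in \<open>\<parallel>x\<parallel>\<close> because \<open>\<alpha> \<le> l\<close>. If \<open>\<alpha> > -1\<close> it is therefore
  bounded and continuous, and the quadratic form is recovered from the positive Fourier transform by
  Gaussian regularisation; otherwise \<open>W 0 = \<infinity>\<close> and the form is infinite.\<close>

section \<open>Positivity preserving multipliers\<close>

text \<open>The obstacle is strictness. A Bessel square has zeros, and an infinite product is a
  limit, so both yield only weak inequalities. One elementary factor is therefore split off before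
  the limit and applied first: averaging a nonnegative function that is positive at 0 gives a
  positive one. Every later multiplier keeps it positive, because its minimum over a compact
  interval can be subtracted beforehand.

  The order \<open>\<sigma>\<close> and the auxiliary parameters come from asking for equal sums of
  Gamma parameters. The choice \<open>\<sigma> = m/2\<close> serves
  \<open>2\<rho> + 1 \<le> m\<close> and requires \<open>m - \<rho> - 1/2 \<le> \<nu>\<close>; the
  choice \<open>\<sigma> = (m + \<rho> + 1/2)/3\<close> serves
  \<open>2\<rho> - 2 \<le> m \<le> 2\<rho> + 1\<close> and requires
  \<open>2m - \<rho> - 1/2 \<le> 3\<nu>\<close>; for \<open>0 < m \<le> 2\<rho> - 2\<close> the
  second requirement, taken at the smaller exponent \<open>m/2 + 1\<close>, reads
  \<open>(m - 1)/2 \<le> \<nu>\<close>. In terms of \<open>l\<close> and \<open>\<alpha>\<close>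
  these are the three bounds in \<open>admissible\<close>.

  The transform itself is computed from even moments: those of the Gaussian give those of the ball
  powers, then those of \<open>W\<close>, which are the coefficients of its cosine
  transform.\<close>

definition entire_coeffs :: "(nat \<Rightarrow> real) \<Rightarrow> bool" where
  "entire_coeffs f \<longleftrightarrow> (\<forall>y. summable (\<lambda>k. f k * y ^ k))"

text \<open>Positivity is asked only on \<open>{0..Y}\<close>, as fits averaging over
  \<open>[0, Y]\<close>. The local form is what permits subtracting a minimum over a compact
  interval in \<open>pos_multiplier_mult\<close>; over the whole half-line the infimum of a positive
  function may be 0.\<close>

definition nonneg_multiplier :: "(nat \<Rightarrow> real) \<Rightarrow> bool" where
  "nonneg_multiplier q \<longleftrightarrow> (\<forall>f Y. entire_coeffs f \<longrightarrow> 0 \<le> Y \<longrightarrow>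
     (\<forall>y\<in>{0..Y}. 0 \<le> (\<Sum>k. f k * y ^ k)) \<longrightarrow> 0 \<le> (\<Sum>k. q k * f k * Y ^ k))"

text \<open>The condition \<open>0 < f 0\<close> rules out the zero series but still lets
  \<open>f\<close> vanish at points of \<open>{0..Y}\<close>, as Bessel squares do.\<close>

definition pos_multiplier :: "(nat \<Rightarrow> real) \<Rightarrow> bool" where
  "pos_multiplier q \<longleftrightarrow> nonneg_multiplier q \<and> (\<forall>f Y. entire_coeffs f \<longrightarrow> 0 \<le> Y \<longrightarrow> 0 < f 0 \<longrightarrow>
     (\<forall>y\<in>{0..Y}. 0 \<le> (\<Sum>k. f k * y ^ k)) \<longrightarrow> 0 < (\<Sum>k. q k * f k * Y ^ k))"

lemma nonneg_multiplierD:
  assumes "nonneg_multiplier q" "entire_coeffs f" "0 \<le> Y" "\<And>y. 0 \<le> y \<Longrightarrow> y \<le> Y \<Longrightarrow> 0 \<le> (\<Sum>k. f k * y ^ k)"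
  shows "0 \<le> (\<Sum>k. q k * f k * Y ^ k)"
  using assms unfolding nonneg_multiplier_def by simp

lemma pos_multiplierD:
  assumes "pos_multiplier q" "entire_coeffs f" "0 \<le> Y" "0 < f 0"
    "\<And>y. 0 \<le> y \<Longrightarrow> y \<le> Y \<Longrightarrow> 0 \<le> (\<Sum>k. f k * y ^ k)"
  shows "0 < (\<Sum>k. q k * f k * Y ^ k)"
  using assms unfolding pos_multiplier_def by simp

lemma pos_multiplier_imp_nonneg: "pos_multiplier q \<Longrightarrow> nonneg_multiplier q"
  by (simp add: pos_multiplier_def)

lemma entire_coeffs_abs:
  assumes "entire_coeffs f" shows "summable (\<lambda>k. \<bar>f k * y ^ k\<bar>)"
proof -
  have "summable (\<lambda>k. f k * (\<bar>y\<bar> + 1) ^ k)" using assms by (simp add: entire_coeffs_def)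
  then have "summable (\<lambda>k. norm (f k * y ^ k))"
    by (rule powser_insidea) simp
  then show ?thesis by simp
qed

lemma entire_coeffs_bounded_mult:
  assumes "entire_coeffs f" "\<And>k. \<bar>q k\<bar> \<le> B"
  shows "entire_coeffs (\<lambda>k. q k * f k)"
  unfolding entire_coeffs_def
proof
  fix y
  have "summable (\<lambda>k. B * \<bar>f k * y ^ k\<bar>)"
    by (intro summable_mult entire_coeffs_abs assms)
  then show "summable (\<lambda>k. q k * f k * y ^ k)"
    by (rule summable_comparison_test') (simp add: abs_mult mult_right_mono assms mult.assoc)
qed

lemma entire_coeffs_finite:
  assumes "finite A" "\<And>k. k \<notin> A \<Longrightarrow> f k = 0" shows "entire_coeffs f"
  unfolding entire_coeffs_def using assms by (auto intro!: summable_finite[of A])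

text \<open>Test on the polynomials \<open>y ^ k\<close> and \<open>1 - y ^ k\<close>, both
  nonnegative on \<open>[0, 1]\<close>, and evaluate at \<open>Y = 1\<close>. The resulting bound
  keeps series entire and provides the domination for limits of multipliers.\<close>

lemma nonneg_multiplier_bounds:
  assumes q: "nonneg_multiplier q"
  shows "0 \<le> q k" "q k \<le> q 0"
proof -
  have s: "(\<Sum>j. (if j = k then 1 else 0) * y ^ j) = y ^ k" for y :: real
    using sums_single[of k "\<lambda>j. y ^ j"] by (simp add: sums_iff if_distrib[of "\<lambda>x. x * _"] cong: if_cong)
  have "0 \<le> (\<Sum>j. q j * (if j = k then 1 else 0) * 1 ^ j)"
    by (intro nonneg_multiplierD[OF q] entire_coeffs_finite[of "{k}"]) (auto simp: s)
  also have "\<dots> = q k"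
    using sums_single[of k q] by (simp add: sums_iff if_distrib[of "\<lambda>x. _ * x"] cong: if_cong)
  finally show "0 \<le> q k" .
  show "q k \<le> q 0"
  proof (cases "k = 0")
    case False
    define g :: "nat \<Rightarrow> real" where "g = (\<lambda>j. if j = 0 then 1 else if j = k then -1 else 0)"
    have gs: "(\<Sum>j. w j * g j * y ^ j) = w 0 - w k * y ^ k" for y :: real and w :: "nat \<Rightarrow> real"
      using False suminf_finite[of "{0, k}" "\<lambda>j. w j * g j * y ^ j"] by (auto simp: g_def)
    have "0 \<le> (\<Sum>j. q j * g j * 1 ^ j)"
    proof (intro nonneg_multiplierD[OF q] entire_coeffs_finite[of "{0, k}"])
      fix y :: real assume y: "0 \<le> y" "y \<le> 1"
      then have "y ^ k \<le> 1" by (simp add: power_le_one)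
      with gs[of "\<lambda>_. 1" y] show "0 \<le> (\<Sum>j. g j * y ^ j)" by simp
    qed (auto simp: g_def)
    with gs[of q 1] show ?thesis by simp
  qed simp
qed

lemma entire_coeffs_mult:
  assumes "nonneg_multiplier q" "entire_coeffs f"
  shows "entire_coeffs (\<lambda>k. q k * f k)"
  by (rule entire_coeffs_bounded_mult[OF assms(2), of _ "q 0"])
     (use nonneg_multiplier_bounds[OF assms(1)] in \<open>simp add: abs_of_nonneg\<close>)

lemma nonneg_multiplier_const: "0 \<le> c \<Longrightarrow> nonneg_multiplier (\<lambda>_. c)"
  unfolding nonneg_multiplier_def
  by (auto simp: mult.assoc suminf_mult entire_coeffs_def)

lemma nonneg_multiplier_mult:
  assumes p: "nonneg_multiplier p" and q: "nonneg_multiplier q"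
  shows "nonneg_multiplier (\<lambda>k. p k * q k)"
  unfolding nonneg_multiplier_def
proof safe
  fix f :: "nat \<Rightarrow> real" and Y :: real
  assume f: "entire_coeffs f" "0 \<le> Y" "\<forall>y\<in>{0..Y}. 0 \<le> (\<Sum>k. f k * y ^ k)"
  have "0 \<le> (\<Sum>k. q k * f k * y ^ k)" if "0 \<le> y" "y \<le> Y" for y
    using f that by (intro nonneg_multiplierD[OF q]) auto
  then have "0 \<le> (\<Sum>k. p k * (q k * f k) * Y ^ k)"
    using f by (intro nonneg_multiplierD[OF p] entire_coeffs_mult[OF q]) auto
  then show "0 \<le> (\<Sum>k. p k * q k * f k * Y ^ k)" by (simp add: mult.assoc)
qed

lemma entire_coeffs_continuous:
  assumes "entire_coeffs f" shows "continuous_on A (\<lambda>y. \<Sum>k. f k * y ^ k)"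
proof (rule continuous_at_imp_continuous_on, rule ballI)
  fix x show "isCont (\<lambda>y. \<Sum>k. f k * y ^ k) x"
    using assms by (intro DERIV_isCont[OF termdiffs_strong_converges_everywhere])
      (auto simp: entire_coeffs_def)
qed

text \<open>After \<open>q\<close> the function \<open>h\<close> is strictly positive on the compact
  interval, with minimum \<open>h y0 > 0\<close>. Applying \<open>p\<close> to the nonnegative
  function \<open>h - h y0\<close> leaves at least \<open>p 0 * h y0 > 0\<close>, since a constant
  is merely scaled by \<open>p 0\<close>.\<close>

lemma pos_multiplier_mult:
  assumes p: "nonneg_multiplier p" "0 < p 0" and q: "pos_multiplier q"
  shows "pos_multiplier (\<lambda>k. p k * q k)"
  unfolding pos_multiplier_def
proof (intro conjI allI impI nonneg_multiplier_mult p pos_multiplier_imp_nonneg[OF q])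
  fix f :: "nat \<Rightarrow> real" and Y :: real
  assume f: "entire_coeffs f" "0 \<le> Y" "0 < f 0" "\<forall>y\<in>{0..Y}. 0 \<le> (\<Sum>k. f k * y ^ k)"
  define h where "h = (\<lambda>y. \<Sum>k. q k * f k * y ^ k)"
  have e: "entire_coeffs (\<lambda>k. q k * f k)"
    using entire_coeffs_mult[OF pos_multiplier_imp_nonneg[OF q] f(1)] .
  obtain y0 where y0: "y0 \<in> {0..Y}" "\<And>y. y \<in> {0..Y} \<Longrightarrow> h y0 \<le> h y"
    using continuous_attains_inf[of "{0..Y}" h] entire_coeffs_continuous[OF e] f(2)
    by (auto simp: h_def)
  have "h y0 > 0"
    unfolding h_def using f y0(1) by (intro pos_multiplierD[OF q]) auto
  define g where "g = (\<lambda>k. q k * f k - (if k = 0 then h y0 else 0))"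
  have s0: "summable (\<lambda>k. q k * f k * y ^ k)" for y
    using e by (auto simp: entire_coeffs_def)
  have s1: "(\<lambda>k. (if k = 0 then h y0 else 0) * y ^ k) sums h y0" for y
    using sums_single[of 0 "\<lambda>_. h y0"] by (rule sums_cong[THEN iffD1, rotated]) auto
  have s2: "(\<lambda>k. p k * (if k = 0 then h y0 else 0) * y ^ k) sums (p 0 * h y0)" for y
    using sums_single[of 0 "\<lambda>_. p 0 * h y0"] by (rule sums_cong[THEN iffD1, rotated]) auto
  have gs: "(\<lambda>k. g k * y ^ k) sums (h y - h y0)" for y
    using sums_diff[OF summable_sums[OF s0[of y]] s1[of y]]
    unfolding g_def left_diff_distrib h_def .
  have "0 \<le> (\<Sum>k. p k * g k * Y ^ k)"
    using gs y0 by (intro nonneg_multiplierD[OF p(1)] f(2)) (auto simp: entire_coeffs_def sums_iff)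
  moreover have "(\<lambda>k. p k * g k * Y ^ k) sums ((\<Sum>k. p k * (q k * f k) * Y ^ k) - p 0 * h y0)"
    unfolding g_def right_diff_distrib left_diff_distrib
    using entire_coeffs_mult[OF p(1) e] by (intro sums_diff s2 summable_sums) (auto simp: entire_coeffs_def)
  ultimately have "p 0 * h y0 \<le> (\<Sum>k. p k * (q k * f k) * Y ^ k)" by (simp add: sums_iff)
  moreover have "0 < p 0 * h y0" using \<open>h y0 > 0\<close> p(2) by simp
  ultimately show "0 < (\<Sum>k. p k * q k * f k * Y ^ k)" by (simp add: mult.assoc)
qed

lemma pos_multiplier_add:
  assumes p: "nonneg_multiplier p" and q: "pos_multiplier q"
  shows "pos_multiplier (\<lambda>k. p k + q k)"
proof -
  have s: "(\<Sum>k. (p k + q k) * f k * Y ^ k) = (\<Sum>k. p k * f k * Y ^ k) + (\<Sum>k. q k * f k * Y ^ k)"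
    if "entire_coeffs f" for f Y
    using entire_coeffs_mult[OF p that] entire_coeffs_mult[OF pos_multiplier_imp_nonneg[OF q] that]
    by (simp add: entire_coeffs_def distrib_right suminf_add)
  show ?thesis
    unfolding pos_multiplier_def nonneg_multiplier_def
    using nonneg_multiplierD[OF p] nonneg_multiplierD[OF pos_multiplier_imp_nonneg[OF q]] pos_multiplierD[OF q]
    by (auto simp: s add_nonneg_nonneg add_nonneg_pos)
qed

text \<open>Each \<open>q n k\<close> lies between 0 and \<open>q n 0\<close>, and the convergent
  sequence \<open>q n 0\<close> is bounded, so Tannery's theorem applies. Only the weak inequality
  survives the limit.\<close>

lemma nonneg_multiplier_LIMSEQ:
  assumes q: "\<And>n. nonneg_multiplier (q n)" and lim: "\<And>k. (\<lambda>n. q n k) \<longlonglongrightarrow> r k"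
  shows "nonneg_multiplier r"
  unfolding nonneg_multiplier_def
proof safe
  fix f :: "nat \<Rightarrow> real" and Y :: real
  assume f: "entire_coeffs f" "0 \<le> Y" "\<forall>y\<in>{0..Y}. 0 \<le> (\<Sum>k. f k * y ^ k)"
  obtain B where B: "\<And>n. norm (q n 0) \<le> B"
    using convergent_imp_Bseq[OF convergentI[OF lim[of 0]]] by (auto elim!: BseqE simp del: real_norm_def)
  have b: "norm (q n k * f k * Y ^ k) \<le> B * \<bar>f k * Y ^ k\<bar>" for n k
    using nonneg_multiplier_bounds[OF q, of n k] B[of n]
    by (auto simp: abs_mult mult.assoc intro!: mult_right_mono)
  have "(\<lambda>n. \<Sum>k. q n k * f k * Y ^ k) \<longlonglongrightarrow> (\<Sum>k. r k * f k * Y ^ k)"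
  proof (rule tannerys_theorem[THEN conjunct2, THEN conjunct2])
    show "((\<lambda>n. q n k * f k * Y ^ k) \<longlongrightarrow> r k * f k * Y ^ k) sequentially" for k
      by (intro tendsto_intros lim)
    show "eventually (\<lambda>(k, n). norm (q n k * f k * Y ^ k) \<le> B * \<bar>f k * Y ^ k\<bar>) (at_top \<times>\<^sub>F sequentially)"
      by (intro always_eventually) (use b in auto)
    show "summable (\<lambda>k. B * \<bar>f k * Y ^ k\<bar>)"
      by (intro summable_mult entire_coeffs_abs f(1))
  qed simp
  moreover have "0 \<le> (\<Sum>k. q n k * f k * Y ^ k)" for n
    using f by (intro nonneg_multiplierD[OF q]) auto
  ultimately show "0 \<le> (\<Sum>k. r k * f k * Y ^ k)"
    using LIMSEQ_le_const by blast
qed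

text \<open>The multiplier is the averaging \<open>Y \<mapsto> Y\<^sup>-\<^sup>a \<integral>\<^sub>0\<^sup>Y s\<^sup>a\<^sup>-\<^sup>1 f(s) ds\<close>.\<close>

lemma pos_multiplier_inverse:
  assumes a: "0 < a"
  shows "pos_multiplier (\<lambda>k. 1 / (a + real k))"
proof -
  have main: "0 \<le> (\<Sum>k. 1 / (a + real k) * f k * Y ^ k) \<and> (0 < f 0 \<longrightarrow> 0 < (\<Sum>k. 1 / (a + real k) * f k * Y ^ k))"
    if f: "entire_coeffs f" and Y: "0 \<le> Y" and nn: "\<And>y. 0 \<le> y \<Longrightarrow> y \<le> Y \<Longrightarrow> 0 \<le> (\<Sum>k. f k * y ^ k)" for f Y
  proof -
    define g where "g = (\<lambda>k. 1 / (a + real k) * f k)"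
    have "\<bar>1 / (a + real k)\<bar> \<le> 1 / a" for k using a by (auto simp: field_simps)
    then have g: "entire_coeffs g" unfolding g_def by (rule entire_coeffs_bounded_mult[OF f])
    define G where "G = (\<lambda>y. \<Sum>k. g k * y ^ k)"
    define F where "F = (\<lambda>y. \<Sum>k. f k * y ^ k)"
    have G': "(G has_field_derivative (\<Sum>k. diffs g k * y ^ k)) (at y)" for y
      unfolding G_def using g by (intro termdiffs_strong_converges_everywhere) (auto simp: entire_coeffs_def)
    have sg: "summable (\<lambda>k. g k * y ^ k)" for y using g by (auto simp: entire_coeffs_def)
    \<comment> \<open>This is the differential equation \<open>a G + y G' = F\<close>. Multiplied by
      \<open>y powr (a - 1)\<close> it says that \<open>y powr a * G y\<close> has derivative
      \<open>y powr (a - 1) * F y\<close>; hence the sign of \<open>F\<close> controls the growth of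
      \<open>h\<close> below.\<close>
    have id: "a * G y + y * (\<Sum>k. diffs g k * y ^ k) = F y" for y
    proof -
      have "(\<lambda>k. diffs g k * y ^ k) sums (\<Sum>k. diffs g k * y ^ k)"
        using g termdiff_converges_all[of g y] by (intro summable_sums) (auto simp: entire_coeffs_def)
      from sums_mult[OF this, of y]
      have "(\<lambda>k. real (Suc k) * g (Suc k) * y ^ Suc k) sums (y * (\<Sum>k. diffs g k * y ^ k))"
        by (simp add: diffs_def mult_ac)
      from sums_Suc[OF this]
      have "(\<lambda>k. real k * g k * y ^ k) sums (y * (\<Sum>k. diffs g k * y ^ k))" by simp
      moreover have "(\<lambda>k. a * (g k * y ^ k)) sums (a * G y)"
        unfolding G_def by (intro sums_mult summable_sums sg)
      ultimately have "(\<lambda>k. a * (g k * y ^ k) + real k * g k * y ^ k) sums (a * G y + y * (\<Sum>k. diffs g k * y ^ k))"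
        by (intro sums_add)
      moreover have "a * (g k * y ^ k) + real k * g k * y ^ k = f k * y ^ k" for k
      proof -
        have "a * (g k * y ^ k) + real k * g k * y ^ k = (a + real k) * g k * y ^ k" by (simp add: algebra_simps)
        also have "(a + real k) * g k = f k" using a by (simp add: g_def)
        finally show ?thesis .
      qed
      ultimately show ?thesis by (simp add: F_def sums_iff)
    qed
    define h where "h = (\<lambda>s. s powr a * G s)"
    have h': "(h has_field_derivative (s powr (a - 1) * F s)) (at s)" if "0 < s" for s
    proof -
      have "(h has_field_derivative (a * s powr (a - 1) * G s + s powr a * (\<Sum>k. diffs g k * s ^ k))) (at s)"
        unfolding h_def using that by (auto intro!: derivative_eq_intros G')
      also have "a * s powr (a - 1) * G s + s powr a * (\<Sum>k. diffs g k * s ^ k)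
         = s powr (a - 1) * (a * G s + s * (\<Sum>k. diffs g k * s ^ k))"
        using that by (simp add: powr_diff field_simps)
      finally show ?thesis by (simp add: id)
    qed
    have hcont: "continuous_on {0..Y} h"
      unfolding h_def G_def using a entire_coeffs_continuous[OF g]
      by (intro continuous_intros continuous_on_powr') auto
    have h0: "h 0 = 0" using a by (simp add: h_def)
    have mono: "h s \<le> h t" if st: "0 \<le> s" "s \<le> t" "t \<le> Y" for s t
    proof (rule DERIV_nonneg_imp_increasing_open[OF st(2)])
      fix x assume x: "s < x" "x < t"
      then show "\<exists>y. (h has_real_derivative y) (at x) \<and> 0 \<le> y"
        using st h'[of x] nn[of x] by (auto simp: F_def)
    qed (rule continuous_on_subset[OF hcont], use st in auto)
    show ?thesis
    proof (cases "Y = 0")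
      case True
      have G0: "G 0 = f 0 / a" unfolding G_def using powser_zero[of g] by (simp add: g_def)
      have F0: "F 0 = f 0" unfolding F_def using powser_zero[of f] by simp
      have "0 \<le> f 0" using nn[of 0] Y F0 by (simp add: F_def)
      then show ?thesis using G0 a True by (auto simp: G_def g_def)
    next
      case False
      then have Y: "0 < Y" using Y by simp
      have "h 0 \<le> h Y" using mono[of 0 Y] Y by auto
      then have 1: "0 \<le> G Y" using Y h0 by (simp add: h_def zero_le_mult_iff)
      \<comment> \<open>\<open>F\<close> may vanish further out, but it is positive near 0, so
        \<open>h\<close> rises strictly on a short initial interval and does not fall
        afterwards.\<close>
      have 2: "0 < G Y" if f0: "0 < f 0"
      proof -
        have "isCont F 0" using entire_coeffs_continuous[OF f, of UNIV] 
          by (simp add: F_def continuous_on_eq_continuous_at)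
        moreover have "F 0 > 0" using f0 unfolding F_def using powser_zero[of f] by simp
        ultimately have "eventually (\<lambda>x. F x > 0) (at 0)"
          unfolding continuous_at by (rule order_tendstoD)
        then obtain d where d: "d > 0" "\<And>x. x \<noteq> 0 \<Longrightarrow> \<bar>x\<bar> < d \<Longrightarrow> F x > 0"
          by (auto simp: eventually_at dist_real_def)
        define t where "t = min (d / 2) Y"
        have t: "0 < t" "t < d" "t \<le> Y" using d Y by (auto simp: t_def)
        have "h 0 < h t"
        proof (rule DERIV_pos_imp_increasing_open[OF t(1)])
          fix x assume x: "0 < x" "x < t"
          then show "\<exists>y. (h has_real_derivative y) (at x) \<and> 0 < y"
            using t h'[of x] d(2)[of x] by auto
        qed (rule continuous_on_subset[OF hcont], use t in auto)
        also have "h t \<le> h Y" using t by (intro mono) auto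
        finally show ?thesis using Y h0 by (simp add: h_def zero_less_mult_iff)
      qed
      show ?thesis using 1 2 by (auto simp: G_def g_def)
    qed
  qed
  then show ?thesis unfolding pos_multiplier_def nonneg_multiplier_def by auto
qed

lemma pos_multiplier_scale:
  assumes "0 < c" "pos_multiplier q" shows "pos_multiplier (\<lambda>k. c * q k)"
  using pos_multiplier_mult[OF nonneg_multiplier_const[of c] _ assms(2)] assms(1) by simp

text \<open>The quotient is \<open>1 + (b - a) / (a + k)\<close>: the identity plus a positive
  multiple of an averaging.\<close>

lemma pos_multiplier_shift_quotient:
  assumes "0 < a" "a < b"
  shows "pos_multiplier (\<lambda>k. (b + real k) / (a + real k))"
proof -
  have "pos_multiplier (\<lambda>k. 1 + (b - a) * (1 / (a + real k)))"
    using assms by (intro pos_multiplier_add nonneg_multiplier_const pos_multiplier_scale pos_multiplier_inverse) auto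
  also have "(\<lambda>k. 1 + (b - a) * (1 / (a + real k))) = (\<lambda>k. (b + real k) / (a + real k))"
    using assms by (intro ext) (simp add: field_simps)
  finally show ?thesis .
qed

text \<open>Equal sums cancel the linear terms in \<open>k\<close>, so numerator and denominator
  differ by the constant \<open>b1 * b2 - a1 * a2 = (b1 - a1) * (b2 - a1)\<close>. The quotient is
  the identity plus a positive multiple of two successive averagings.\<close>

lemma pos_multiplier_shift_quotient2:
  assumes "0 < a1" "a1 < b1" "a1 < b2" "a1 + a2 = b1 + b2"
  shows "pos_multiplier (\<lambda>k. ((b1 + real k) * (b2 + real k)) / ((a1 + real k) * (a2 + real k)))"
proof -
  have a2: "a2 = b1 + b2 - a1" using assms by simp
  have "pos_multiplier (\<lambda>k. 1 + ((b1 - a1) * (b2 - a1)) * (1 / (a1 + real k) * (1 / (a2 + real k))))"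
    using assms by (intro pos_multiplier_add nonneg_multiplier_const pos_multiplier_scale
      pos_multiplier_mult pos_multiplier_inverse pos_multiplier_imp_nonneg[OF pos_multiplier_inverse]) auto
  also have "(\<lambda>k. 1 + ((b1 - a1) * (b2 - a1)) * (1 / (a1 + real k) * (1 / (a2 + real k)))) =
      (\<lambda>k. ((b1 + real k) * (b2 + real k)) / ((a1 + real k) * (a2 + real k)))"
  proof
    fix k
    define z where "z = real k"
    have p: "a1 + z > 0" "a2 + z > 0" using assms by (auto simp: z_def)
    have "(b1 + z) * (b2 + z) = (a1 + z) * (a2 + z) + (b1 - a1) * (b2 - a1)"
      unfolding a2 by (simp add: algebra_simps)
    with p show "1 + ((b1 - a1) * (b2 - a1)) * (1 / (a1 + real k) * (1 / (a2 + real k))) =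
      ((b1 + real k) * (b2 + real k)) / ((a1 + real k) * (a2 + real k))"
      unfolding z_def by (simp add: add_divide_distrib)
  qed
  finally show ?thesis .
qed

section \<open>Quotients of Gamma functions as multipliers\<close>

lemma nonneg_multiplier_prod:
  assumes "\<And>j. j \<in> A \<Longrightarrow> nonneg_multiplier (q j)"
  shows "nonneg_multiplier (\<lambda>k. \<Prod>j\<in>A. q j k)"
  using assms by (induction A rule: infinite_finite_induct) (auto intro!: nonneg_multiplier_mult nonneg_multiplier_const)

lemma Gamma_series_eq_prod:
  fixes z :: real
  shows "Gamma_series z n = fact n * exp (z * ln (real n)) / (\<Prod>j\<in>{0..n}. z + real j)"
  by (simp add: Gamma_series_def pochhammer_Suc_prod atLeast0AtMost)

text \<open>In the quotient of the two \<open>Gamma_series\<close> the factorials cancel and the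
  powers of \<open>n\<close> combine to a factor independent of \<open>k\<close>. What remains is a
  finite product of shift quotients, with the denominators of \<open>Gamma_series\<close> trading
  places.\<close>

lemma nonneg_multiplier_Gamma_quotient:
  assumes a: "0 < a" "a \<le> b"
  shows "nonneg_multiplier (\<lambda>k. Gamma (a + real k) / Gamma (b + real k))"
proof (rule nonneg_multiplier_LIMSEQ)
  fix n
  have "nonneg_multiplier (\<lambda>k. exp ((a - b) * ln (real n)) * (\<Prod>j\<in>{0..n}. (b + real j + real k) / (a + real j + real k)))"
  proof (intro nonneg_multiplier_mult nonneg_multiplier_prod nonneg_multiplier_const)
    fix j show "nonneg_multiplier (\<lambda>k. (b + real j + real k) / (a + real j + real k))"
    proof (cases "a = b")
      case True
      then have "(\<lambda>k. (b + real j + real k) / (a + real j + real k)) = (\<lambda>_. 1)" using a by auto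
      then show ?thesis by (simp add: nonneg_multiplier_const)
    next
      case False
      then show ?thesis using a by (intro pos_multiplier_imp_nonneg[OF pos_multiplier_shift_quotient]) auto
    qed
  qed auto
  also have "(\<lambda>k. exp ((a - b) * ln (real n)) * (\<Prod>j\<in>{0..n}. (b + real j + real k) / (a + real j + real k)))
    = (\<lambda>k. Gamma_series (a + real k) n / Gamma_series (b + real k) n)"
  proof
    fix k
    have "exp ((a - b) * ln (real n)) = exp ((a + real k) * ln (real n)) / exp ((b + real k) * ln (real n))"
      by (simp add: exp_diff[symmetric] algebra_simps)
    then show "exp ((a - b) * ln (real n)) * (\<Prod>j\<in>{0..n}. (b + real j + real k) / (a + real j + real k)) =
      Gamma_series (a + real k) n / Gamma_series (b + real k) n"
      by (simp add: Gamma_series_eq_prod prod_dividef add_ac)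
  qed
  finally show "nonneg_multiplier (\<lambda>k. Gamma_series (a + real k) n / Gamma_series (b + real k) n)" .
next
  fix k
  show "(\<lambda>n. Gamma_series (a + real k) n / Gamma_series (b + real k) n)
         \<longlonglongrightarrow> Gamma (a + real k) / Gamma (b + real k)"
    using Gamma_real_pos[of "b + real k"] a by (intro tendsto_intros) force
qed

text \<open>With equal parameter sums the powers of \<open>n\<close> in the four
  \<open>Gamma_series\<close> cancel completely, leaving a product of two-term shift quotients.
  Should \<open>a1\<close> equal \<open>b1\<close> or \<open>b2\<close>, both pairs coincide and
  every factor is 1.\<close>

lemma nonneg_multiplier_Gamma_quotient2:
  assumes a: "0 < a1" "a1 \<le> b1" "a1 \<le> b2" "a1 + a2 = b1 + b2"
  shows "nonneg_multiplier (\<lambda>k. (Gamma (a1 + real k) * Gamma (a2 + real k)) / (Gamma (b1 + real k) * Gamma (b2 + real k)))"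
proof (rule nonneg_multiplier_LIMSEQ)
  fix n
  have "nonneg_multiplier (\<lambda>k. \<Prod>j\<in>{0..n}. ((b1 + real j + real k) * (b2 + real j + real k)) / ((a1 + real j + real k) * (a2 + real j + real k)))"
  proof (intro nonneg_multiplier_prod)
    fix j show "nonneg_multiplier (\<lambda>k. ((b1 + real j + real k) * (b2 + real j + real k)) / ((a1 + real j + real k) * (a2 + real j + real k)))"
    proof (cases "a1 = b1 \<or> a1 = b2")
      case True
      then have "{a1, a2} = {b1, b2}" using a by auto
      then have "(\<lambda>k. ((b1 + real j + real k) * (b2 + real j + real k)) / ((a1 + real j + real k) * (a2 + real j + real k))) = (\<lambda>_. 1)"
        using a by (auto simp: doubleton_eq_iff)
      then show ?thesis by (simp add: nonneg_multiplier_const)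
    next
      case False
      then show ?thesis using a by (intro pos_multiplier_imp_nonneg[OF pos_multiplier_shift_quotient2]) auto
    qed
  qed
  also have "(\<lambda>k. \<Prod>j\<in>{0..n}. ((b1 + real j + real k) * (b2 + real j + real k)) / ((a1 + real j + real k) * (a2 + real j + real k)))
    = (\<lambda>k. (Gamma_series (a1 + real k) n * Gamma_series (a2 + real k) n) / (Gamma_series (b1 + real k) n * Gamma_series (b2 + real k) n))"
  proof
    fix k
    have "exp ((a1 + real k) * ln (real n)) * exp ((a2 + real k) * ln (real n))
       = exp ((a1 + a2 + 2 * real k) * ln (real n))"
      by (simp add: exp_add[symmetric] algebra_simps)
    moreover have "exp ((b1 + real k) * ln (real n)) * exp ((b2 + real k) * ln (real n))
       = exp ((b1 + b2 + 2 * real k) * ln (real n))"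
      by (simp add: exp_add[symmetric] algebra_simps)
    ultimately have "exp ((a1 + real k) * ln (real n)) * exp ((a2 + real k) * ln (real n)) =
      exp ((b1 + real k) * ln (real n)) * exp ((b2 + real k) * ln (real n))"
      using a by simp
    moreover have "((F * ea / P1) * (F * ea' / P2)) / ((F * eb / Q1) * (F * eb' / Q2)) = (Q1 * Q2) / (P1 * P2)"
      if "ea * ea' = eb * eb'" "eb \<noteq> 0" "eb' \<noteq> 0" "F \<noteq> 0" for F ea ea' eb eb' P1 P2 Q1 Q2 :: real
    proof -
      have "((F * ea / P1) * (F * ea' / P2)) / ((F * eb / Q1) * (F * eb' / Q2))
        = (F * F * (ea * ea') * (Q1 * Q2)) / (F * F * (eb * eb') * (P1 * P2))" by (simp add: mult_ac)
      also have "\<dots> = (Q1 * Q2) / (P1 * P2)" using that by simp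
      finally show ?thesis .
    qed
    ultimately have "(fact n * exp ((a1 + real k) * ln (real n)) / (\<Prod>j\<in>{0..n}. a1 + real k + real j) *
       (fact n * exp ((a2 + real k) * ln (real n)) / (\<Prod>j\<in>{0..n}. a2 + real k + real j))) /
      (fact n * exp ((b1 + real k) * ln (real n)) / (\<Prod>j\<in>{0..n}. b1 + real k + real j) *
       (fact n * exp ((b2 + real k) * ln (real n)) / (\<Prod>j\<in>{0..n}. b2 + real k + real j))) =
      ((\<Prod>j\<in>{0..n}. b1 + real k + real j) * (\<Prod>j\<in>{0..n}. b2 + real k + real j)) /
      ((\<Prod>j\<in>{0..n}. a1 + real k + real j) * (\<Prod>j\<in>{0..n}. a2 + real k + real j))"
      by (metis exp_not_eq_zero fact_nonzero)
    then show "(\<Prod>j\<in>{0..n}. ((b1 + real j + real k) * (b2 + real j + real k)) / ((a1 + real j + real k) * (a2 + real j + real k))) =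
      (Gamma_series (a1 + real k) n * Gamma_series (a2 + real k) n) / (Gamma_series (b1 + real k) n * Gamma_series (b2 + real k) n)"
      unfolding Gamma_series_eq_prod by (simp only: prod_dividef prod.distrib add_ac)
  qed
  finally show "nonneg_multiplier (\<lambda>k. (Gamma_series (a1 + real k) n * Gamma_series (a2 + real k) n) / (Gamma_series (b1 + real k) n * Gamma_series (b2 + real k) n))" .
next
  fix k
  show "(\<lambda>n. (Gamma_series (a1 + real k) n * Gamma_series (a2 + real k) n) / (Gamma_series (b1 + real k) n * Gamma_series (b2 + real k) n))
         \<longlonglongrightarrow> (Gamma (a1 + real k) * Gamma (a2 + real k)) / (Gamma (b1 + real k) * Gamma (b2 + real k))"
    using Gamma_real_pos[of "b1 + real k"] Gamma_real_pos[of "b2 + real k"] a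
    by (intro tendsto_intros) (smt (verit) mult_eq_0_iff of_nat_0_le_iff)
qed

lemma Gamma_real_plus1: "0 < z \<Longrightarrow> Gamma (z + 1) = z * Gamma (z::real)"
  using Gamma_plus1[of z] by (auto simp: nonpos_Ints_def)

text \<open>The limit behind the nonnegative version loses strictness. The functional equation
  splits off the factor \<open>(b + k) / (a + k)\<close>, which is strict by itself; the rest is a
  Gamma quotient with both parameters raised by 1.\<close>

lemma pos_multiplier_Gamma_quotient:
  assumes a: "0 < a" "a < b"
  shows "pos_multiplier (\<lambda>k. Gamma (a + real k) / Gamma (b + real k))"
proof -
  have "pos_multiplier (\<lambda>k. (Gamma (a + 1 + real k) / Gamma (b + 1 + real k)) * ((b + real k) / (a + real k)))"
    using a by (intro pos_multiplier_mult nonneg_multiplier_Gamma_quotient pos_multiplier_shift_quotient)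
      (auto intro!: divide_pos_pos Gamma_real_pos)
  also have "(\<lambda>k. (Gamma (a + 1 + real k) / Gamma (b + 1 + real k)) * ((b + real k) / (a + real k)))
     = (\<lambda>k. Gamma (a + real k) / Gamma (b + real k))"
  proof
    fix k
    have "a + real k > 0" "b + real k > 0" using a by auto
    then show "(Gamma (a + 1 + real k) / Gamma (b + 1 + real k)) * ((b + real k) / (a + real k))
       = Gamma (a + real k) / Gamma (b + real k)"
      using Gamma_real_plus1[of "a + real k"] Gamma_real_plus1[of "b + real k"] by (simp add: add_ac)
  qed
  finally show ?thesis .
qed

lemma pos_multiplier_Gamma_quotient2:
  assumes a: "0 < a1" "a1 < b1" "a1 < b2" "a1 + a2 = b1 + b2"
  shows "pos_multiplier (\<lambda>k. (Gamma (a1 + real k) * Gamma (a2 + real k)) / (Gamma (b1 + real k) * Gamma (b2 + real k)))"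
proof -
  have "pos_multiplier (\<lambda>k. ((Gamma (a1 + 1 + real k) * Gamma (a2 + 1 + real k)) / (Gamma (b1 + 1 + real k) * Gamma (b2 + 1 + real k)))
     * (((b1 + real k) * (b2 + real k)) / ((a1 + real k) * (a2 + real k))))"
    using a by (intro pos_multiplier_mult nonneg_multiplier_Gamma_quotient2 pos_multiplier_shift_quotient2)
      (auto intro!: divide_pos_pos mult_pos_pos Gamma_real_pos)
  also have "(\<lambda>k. ((Gamma (a1 + 1 + real k) * Gamma (a2 + 1 + real k)) / (Gamma (b1 + 1 + real k) * Gamma (b2 + 1 + real k)))
     * (((b1 + real k) * (b2 + real k)) / ((a1 + real k) * (a2 + real k))))
     = (\<lambda>k. (Gamma (a1 + real k) * Gamma (a2 + real k)) / (Gamma (b1 + real k) * Gamma (b2 + real k)))"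
  proof
    fix k
    have p: "a1 + real k > 0" "b1 + real k > 0" "a2 + real k > 0" "b2 + real k > 0" using a by auto
    have "Gamma (z + 1 + real k) = (z + real k) * Gamma (z + real k)" if "z + real k > 0" for z :: real
      using Gamma_real_plus1[OF that] by (simp add: add_ac)
    then show "((Gamma (a1 + 1 + real k) * Gamma (a2 + 1 + real k)) / (Gamma (b1 + 1 + real k) * Gamma (b2 + 1 + real k)))
     * (((b1 + real k) * (b2 + real k)) / ((a1 + real k) * (a2 + real k)))
     = (Gamma (a1 + real k) * Gamma (a2 + real k)) / (Gamma (b1 + real k) * Gamma (b2 + real k))"
      using p by (simp add: mult_ac)
  qed
  finally show ?thesis .
qed

section \<open>Bessel squares and the Bessel integral\<close>

definition nonneg_series :: "(nat \<Rightarrow> real) \<Rightarrow> bool" where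
  "nonneg_series f \<longleftrightarrow> entire_coeffs f \<and> 0 < f 0 \<and> (\<forall>y\<ge>0. 0 \<le> (\<Sum>k. f k * y ^ k))"

definition pos_series :: "(nat \<Rightarrow> real) \<Rightarrow> bool" where
  "pos_series f \<longleftrightarrow> entire_coeffs f \<and> (\<forall>y\<ge>0. 0 < (\<Sum>k. f k * y ^ k))"

lemma pos_series_mult:
  assumes "pos_multiplier q" "nonneg_series f" shows "pos_series (\<lambda>k. q k * f k)"
  using assms pos_multiplierD[OF assms(1)] entire_coeffs_mult[OF pos_multiplier_imp_nonneg]
  by (auto simp: pos_series_def nonneg_series_def)

text \<open>\<open>Gamma\<close> may decrease from \<open>s\<close> to \<open>s + 1\<close> when
  \<open>s < 1\<close>, whence the minimum; from \<open>s + 1\<close> on, each unit step multiplies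
  by a factor of at least 1. This makes reciprocals of \<open>Gamma\<close> bounded along the
  series.\<close>

lemma Gamma_add_ge:
  fixes s :: real assumes "0 < s" shows "min (Gamma s) (Gamma (s + 1)) \<le> Gamma (s + real k)"
proof (cases k)
  case (Suc j)
  have "Gamma (s + 1) \<le> Gamma (s + real (Suc j))"
  proof (induction j)
    case (Suc j)
    have "0 < Gamma (s + real (Suc j))" using assms by (intro Gamma_real_pos) auto
    then have "1 * Gamma (s + real (Suc j)) \<le> (s + real (Suc j)) * Gamma (s + real (Suc j))"
      using assms by (intro mult_right_mono) auto
    also have "\<dots> = Gamma (s + real (Suc (Suc j)))"
      using Gamma_real_plus1[of "s + real (Suc j)"] assms by (simp add: add_ac)
    finally show ?case using Suc by linarith
  qed simp
  then show ?thesis using Suc by (simp add: min.coboundedI2)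
qed simp

text \<open>Legendre duplication through Pochhammer symbols. The constant is left as a quotient of
  Gamma values, since only its positivity and its independence of \<open>k\<close> matter.\<close>

lemma Gamma_double_shift:
  fixes z :: real assumes z: "0 < z"
  shows "Gamma (z + 2 * real k) =
    Gamma z / (Gamma (z / 2) * Gamma ((z + 1) / 2)) * 4 ^ k * Gamma (z / 2 + real k) * Gamma ((z + 1) / 2 + real k)"
proof -
  have p: "Gamma (x + real j) = Gamma x * pochhammer x j" if "0 < x" for x :: real and j
    using pochhammer_Gamma[of x j] Gamma_real_pos[OF that] that by (auto simp: nonpos_Ints_def field_simps)
  have "Gamma (z + 2 * real k) = Gamma z * pochhammer (2 * (z / 2)) (2 * k)"
    using p[OF z, of "2 * k"] by simp
  also have "pochhammer (2 * (z / 2)) (2 * k) = 4 ^ k * pochhammer (z / 2) k * pochhammer ((z + 1) / 2) k"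
    by (subst pochhammer_double) (simp add: power_mult add_divide_distrib)
  also have "Gamma z * (4 ^ k * pochhammer (z / 2) k * pochhammer ((z + 1) / 2) k) =
    Gamma z / (Gamma (z / 2) * Gamma ((z + 1) / 2)) * 4 ^ k * (Gamma (z / 2) * pochhammer (z / 2) k)
      * (Gamma ((z + 1) / 2) * pochhammer ((z + 1) / 2) k)"
    using z less_imp_neq[OF Gamma_real_pos, of "z / 2"] less_imp_neq[OF Gamma_real_pos, of "(z + 1) / 2"] by simp
  also have "\<dots> = Gamma z / (Gamma (z / 2) * Gamma ((z + 1) / 2)) * 4 ^ k * Gamma (z / 2 + real k) * Gamma ((z + 1) / 2 + real k)"
    using p[of "z / 2" k] p[of "(z + 1) / 2" k] z by simp
  finally show ?thesis .
qed

lemma entire_coeffs_exp: "entire_coeffs (\<lambda>k. c ^ k / fact k)"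
  unfolding entire_coeffs_def
proof
  fix y show "summable (\<lambda>k. c ^ k / fact k * y ^ k)"
    using summable_exp[of "c * y"] by (simp add: power_mult_distrib field_simps)
qed

lemma inverse_Gamma_bounded:
  fixes s :: real assumes "0 < s"
  shows "\<bar>1 / Gamma (s + real k)\<bar> \<le> 1 / min (Gamma s) (Gamma (s + 1))"
proof -
  have "0 < min (Gamma s) (Gamma (s + 1))" using assms by (simp add: Gamma_real_pos)
  with Gamma_add_ge[OF assms, of k] show ?thesis by (auto simp: abs_of_pos intro!: divide_left_mono)
qed

text \<open>The coefficients of \<open>J\<^sub>\<sigma>(x/2)\<^sup>2 / x\<^sup>2\<^sup>\<sigma>\<close> in powers of \<open>y = x\<^sup>2\<close>, up to a constant factor.\<close>

definition bessel_square_coeff :: "real \<Rightarrow> nat \<Rightarrow> real" where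
  "bessel_square_coeff \<sigma> k = (-1/4) ^ k * Gamma (\<sigma> + 1/2 + real k) /
     (Gamma (\<sigma> + 1 + real k) * Gamma (2 * \<sigma> + 1 + real k) * fact k)"

lemma nonneg_series_bessel_square:
  assumes \<sigma>: "-1/2 < \<sigma>"
  shows "nonneg_series (bessel_square_coeff \<sigma>)"
proof -
  \<comment> \<open>These are the coefficients of \<open>(x/4) powr (-\<sigma>) * J(x/2)\<close> in
    powers of \<open>y = x\<^sup>2\<close>, for the Bessel function \<open>J\<close> of order
    \<open>\<sigma>\<close>. The plan is to exhibit the given series as a positive multiple of the
    square of this one.\<close>
  define b where "b = (\<lambda>k. (-1/16) ^ k / (fact k * Gamma (\<sigma> + 1 + real k)))"
  have "entire_coeffs (\<lambda>k. 1 / Gamma (\<sigma> + 1 + real k) * ((-1/16) ^ k / fact k))"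
    using \<sigma> by (intro entire_coeffs_bounded_mult[OF entire_coeffs_exp inverse_Gamma_bounded]) auto
  then have eb: "entire_coeffs b" by (simp add: b_def mult_ac)
  \<comment> \<open>The Gamma quotient is a nonnegative multiplier, hence bounded, so the series is
    dominated by an exponential one.\<close>
  have "entire_coeffs (\<lambda>k. Gamma (\<sigma> + 1/2 + real k) / Gamma (\<sigma> + 1 + real k) * (1 / Gamma (2 * \<sigma> + 1 + real k) * ((-1/4) ^ k / fact k)))"
    using \<sigma> by (intro entire_coeffs_mult[OF nonneg_multiplier_Gamma_quotient]
      entire_coeffs_bounded_mult[OF entire_coeffs_exp inverse_Gamma_bounded]) auto
  moreover have "(\<lambda>k. Gamma (\<sigma> + 1/2 + real k) / Gamma (\<sigma> + 1 + real k) * (1 / Gamma (2 * \<sigma> + 1 + real k) * ((-1/4) ^ k / fact k))) = bessel_square_coeff \<sigma>"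
    by (intro ext) (simp add: bessel_square_coeff_def mult_ac)
  ultimately have es: "entire_coeffs (bessel_square_coeff \<sigma>)" by simp
  define C where "C = Gamma (2 * \<sigma> + 1) / (Gamma (\<sigma> + 1/2) * Gamma (\<sigma> + 1))"
  have C: "C > 0" using \<sigma> by (auto simp: C_def intro!: divide_pos_pos mult_pos_pos Gamma_real_pos)
  \<comment> \<open>In the Cauchy square, \<open>b i * b (k - i)\<close> is a common factor times a
    product of two generalised binomials with the same top \<open>\<sigma> + k\<close>. Vandermonde
    sums them to one binomial with top \<open>2 * \<sigma> + 2 * k\<close>, whose Gamma numerator is
    then halved by duplication.\<close>
  have conv: "(\<Sum>i\<le>k. b i * b (k - i)) = C * bessel_square_coeff \<sigma> k" for k
  proof -
    have np: "x \<notin> \<int>\<^sub>\<le>\<^sub>0" if "x > 0" for x :: real using that by (auto simp: nonpos_Ints_def)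
    define g where "g = Gamma (\<sigma> + real k + 1)"
    have g: "g > 0" using \<sigma> by (auto simp: g_def intro!: Gamma_real_pos)
    have "b i * b (k - i) = (-1/16) ^ k / g\<^sup>2 * ((\<sigma> + real k gchoose i) * (\<sigma> + real k gchoose (k - i)))" if "i \<le> k" for i
    proof -
      have "(\<sigma> + real k gchoose i) = g / (fact i * Gamma (\<sigma> + 1 + real (k - i)))"
        using \<sigma> that by (subst gbinomial_Gamma) (auto intro!: np simp: g_def of_nat_diff algebra_simps)
      moreover have "(\<sigma> + real k gchoose (k - i)) = g / (fact (k - i) * Gamma (\<sigma> + 1 + real i))"
        using \<sigma> that by (subst gbinomial_Gamma) (auto intro!: np simp: g_def of_nat_diff algebra_simps)
      moreover have "(-1/16 :: real) ^ i * (-1/16) ^ (k - i) = (-1/16) ^ k"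
        using that by (simp flip: power_add)
      ultimately show ?thesis using g by (simp add: b_def power2_eq_square)
    qed
    then have "(\<Sum>i\<le>k. b i * b (k - i)) = (-1/16) ^ k / g\<^sup>2 * (\<Sum>i=0..k. (\<sigma> + real k gchoose i) * (\<sigma> + real k gchoose (k - i)))"
      by (simp add: sum_distrib_left atLeast0AtMost)
    also have "(\<Sum>i=0..k. (\<sigma> + real k gchoose i) * (\<sigma> + real k gchoose (k - i))) = (2 * \<sigma> + 2 * real k gchoose k)"
      by (subst gbinomial_Vandermonde) (simp add: algebra_simps)
    also have "\<dots> = Gamma (2 * \<sigma> + 1 + 2 * real k) / (fact k * Gamma (2 * \<sigma> + 1 + real k))"
      using \<sigma> by (subst gbinomial_Gamma) (auto intro!: np simp: algebra_simps)
    also have "Gamma (2 * \<sigma> + 1 + 2 * real k) = C * 4 ^ k * Gamma (\<sigma> + 1/2 + real k) * g"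
      using \<sigma> Gamma_double_shift[of "2 * \<sigma> + 1" k] by (simp add: C_def g_def add_divide_distrib add_ac)
    also have "(-1/16) ^ k / g\<^sup>2 * (C * 4 ^ k * Gamma (\<sigma> + 1/2 + real k) * g / (fact k * Gamma (2 * \<sigma> + 1 + real k)))
       = C * (((-1/16) * 4) ^ k * Gamma (\<sigma> + 1/2 + real k) / (g * Gamma (2 * \<sigma> + 1 + real k) * fact k))"
      using g unfolding power_mult_distrib by (simp add: power2_eq_square mult_ac)
    finally show ?thesis by (simp add: bessel_square_coeff_def g_def add_ac)
  qed
  have "0 \<le> (\<Sum>k. bessel_square_coeff \<sigma> k * y ^ k)" for y
  proof -
    have "(\<Sum>k. b k * y ^ k) * (\<Sum>k. b k * y ^ k) = (\<Sum>k. \<Sum>i\<le>k. (b i * y ^ i) * (b (k - i) * y ^ (k - i)))"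
      using entire_coeffs_abs[OF eb, of y] by (intro Cauchy_product) auto
    also have "(\<lambda>k. \<Sum>i\<le>k. (b i * y ^ i) * (b (k - i) * y ^ (k - i))) = (\<lambda>k. C * (bessel_square_coeff \<sigma> k * y ^ k))"
    proof
      fix k
      have "(\<Sum>i\<le>k. (b i * y ^ i) * (b (k - i) * y ^ (k - i))) = (\<Sum>i\<le>k. b i * b (k - i) * y ^ k)"
        by (intro sum.cong refl) (simp add: mult_ac flip: power_add)
      then show "(\<Sum>i\<le>k. (b i * y ^ i) * (b (k - i) * y ^ (k - i))) = C * (bessel_square_coeff \<sigma> k * y ^ k)"
        by (simp add: conv flip: sum_distrib_right)
    qed
    also have "(\<Sum>k. C * (bessel_square_coeff \<sigma> k * y ^ k)) = C * (\<Sum>k. bessel_square_coeff \<sigma> k * y ^ k)"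
      using es by (intro suminf_mult) (auto simp: entire_coeffs_def)
    finally show ?thesis using C by (metis zero_le_mult_iff zero_le_square not_le)
  qed
  moreover have "0 < bessel_square_coeff \<sigma> 0"
    using \<sigma> by (auto simp: bessel_square_coeff_def intro!: divide_pos_pos mult_pos_pos Gamma_real_pos)
  ultimately show ?thesis using es by (simp add: nonneg_series_def)
qed

text \<open>Up to a positive factor, the coefficients of
  \<open>\<integral>\<^sub>0\<^sup>1 u\<^sup>m (1 - u)\<^sup>\<rho> (ux)\<^sup>-\<^sup>\<nu> J\<^sub>\<nu>(ux) du\<close> in powers of \<open>y = x\<^sup>2\<close>.\<close>

definition bessel_integral_coeff :: "real \<Rightarrow> real \<Rightarrow> real \<Rightarrow> nat \<Rightarrow> real" where
  "bessel_integral_coeff m \<nu> \<rho> k = (-1/4) ^ k * (Gamma ((m + 1) / 2 + real k) * Gamma ((m + 2) / 2 + real k)) /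
     (Gamma ((m + \<rho> + 2) / 2 + real k) * Gamma ((m + \<rho> + 3) / 2 + real k) * Gamma (\<nu> + 1 + real k) * fact k)"

lemma Gamma_quotient_pos: "0 < a \<Longrightarrow> 0 < b \<Longrightarrow> 0 < Gamma (a + real k) / Gamma (b + real k)"
  by (intro divide_pos_pos Gamma_real_pos) auto

lemma Gamma_quotient2_pos:
  "0 < a \<Longrightarrow> 0 < b \<Longrightarrow> 0 < c \<Longrightarrow> 0 < d \<Longrightarrow>
    0 < (Gamma (a + real k) * Gamma (b + real k)) / (Gamma (c + real k) * Gamma (d + real k))"
  by (intro divide_pos_pos mult_pos_pos Gamma_real_pos) auto

text \<open>In each of the following cases the quotient of \<^const>\<open>bessel_integral_coeff\<close> and a suitable
  \<^const>\<open>bessel_square_coeff\<close> is a product of Gamma quotients whose numerator parameters majorize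
  the denominator parameters (weakly, where a single quotient occurs); the quotients record the
  successive transfers.\<close>

lemma pos_series_large_m:
  assumes \<rho>: "0 < \<rho>" and m: "2 * \<rho> + 1 \<le> m" and \<nu>: "m - \<rho> - 1/2 \<le> \<nu>"
  shows "pos_series (bessel_integral_coeff m \<nu> \<rho>)"
proof -
  define G where "G = (\<lambda>a k. Gamma (a + real k))"
  define c where "c = (m + \<rho> + 2) / 2"
  \<comment> \<open>Dividing by the Bessel square of order \<open>m/2\<close> leaves numerator
    parameters \<open>m/2 + 1\<close> (twice) and \<open>m + 1\<close> over \<open>c\<close>,
    \<open>c + 1/2\<close> and \<open>\<nu> + 1\<close>. The sums agree exactly when
    \<open>\<nu> + 1 = d\<close>, and \<open>m/2 + 1 \<le> d\<close> is the case condition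
    \<open>2 * \<rho> + 1 \<le> m\<close>. A larger \<open>\<nu>\<close> costs one further single
    quotient.\<close>
  define d where "d = m - \<rho> + 1/2"
  have Gp: "0 < G a k" if "0 < a" for a k using that by (auto simp: G_def intro!: Gamma_real_pos)
  have 1: "pos_multiplier (\<lambda>k. (G (m/2 + 1) k * G (m + 1) k) / (G c k * G (m + 1 - \<rho>/2) k))"
    unfolding G_def using assms by (intro pos_multiplier_Gamma_quotient2) (auto simp: c_def field_simps)
  have 2: "nonneg_multiplier (\<lambda>k. (G (m/2 + 1) k * G (m + 1 - \<rho>/2) k) / (G (c + 1/2) k * G d k))"
    unfolding G_def using assms by (intro nonneg_multiplier_Gamma_quotient2) (auto simp: c_def d_def field_simps)
  have 3: "nonneg_multiplier (\<lambda>k. G d k / G (\<nu> + 1) k)"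
    unfolding G_def using assms by (intro nonneg_multiplier_Gamma_quotient) (auto simp: d_def)
  have "pos_multiplier (\<lambda>k. (G d k / G (\<nu> + 1) k) * ((G (m/2 + 1) k * G (m + 1 - \<rho>/2) k) / (G (c + 1/2) k * G d k) *
      ((G (m/2 + 1) k * G (m + 1) k) / (G c k * G (m + 1 - \<rho>/2) k))))"
    by (intro pos_multiplier_mult 1 2 3; unfold G_def; intro Gamma_quotient_pos Gamma_quotient2_pos)
      (use assms in \<open>auto simp: c_def d_def field_simps\<close>)
  from pos_series_mult[OF this nonneg_series_bessel_square[of "m/2"]]
  have "pos_series (\<lambda>k. (G d k / G (\<nu> + 1) k) * ((G (m/2 + 1) k * G (m + 1 - \<rho>/2) k) / (G (c + 1/2) k * G d k) *
      ((G (m/2 + 1) k * G (m + 1) k) / (G c k * G (m + 1 - \<rho>/2) k))) * bessel_square_coeff (m/2) k)"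
    using assms by simp
  also have "(\<lambda>k. (G d k / G (\<nu> + 1) k) * ((G (m/2 + 1) k * G (m + 1 - \<rho>/2) k) / (G (c + 1/2) k * G d k) *
      ((G (m/2 + 1) k * G (m + 1) k) / (G c k * G (m + 1 - \<rho>/2) k))) * bessel_square_coeff (m/2) k)
    = bessel_integral_coeff m \<nu> \<rho>"
  proof
    fix k
    have "bessel_square_coeff (m/2) k = (-1/4) ^ k * G ((m+1)/2) k / (G (m/2 + 1) k * G (m + 1) k * fact k)"
      by (simp add: bessel_square_coeff_def G_def add_divide_distrib)
    moreover have "bessel_integral_coeff m \<nu> \<rho> k = (-1/4) ^ k * (G ((m+1)/2) k * G (m/2+1) k) / (G c k * G (c + 1/2) k * G (\<nu> + 1) k * fact k)"
      by (simp add: bessel_integral_coeff_def G_def c_def add_divide_distrib add_ac)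
    moreover have "G d k \<noteq> 0" "G (m/2+1) k \<noteq> 0" "G (m+1) k \<noteq> 0" "G (m + 1 - \<rho>/2) k \<noteq> 0"
      by (intro less_imp_neq[symmetric] Gp; use assms in \<open>simp add: d_def\<close>)+
    ultimately show "(G d k / G (\<nu> + 1) k) * ((G (m/2 + 1) k * G (m + 1 - \<rho>/2) k) / (G (c + 1/2) k * G d k) *
      ((G (m/2 + 1) k * G (m + 1) k) / (G c k * G (m + 1 - \<rho>/2) k))) * bessel_square_coeff (m/2) k = bessel_integral_coeff m \<nu> \<rho> k"
      by (simp add: mult_ac)
  qed
  finally show ?thesis .
qed

text \<open>Passing from \<open>\<rho>\<close> to \<open>\<rho>'\<close> is fractional integration; it reduces the case \<open>m < 2 * \<rho>' - 2\<close>
  to \<open>\<rho> = m / 2 + 1\<close>.\<close>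

lemma pos_series_medium_m:
  assumes m: "2 * \<rho> - 2 \<le> m" "m \<le> 2 * \<rho> + 1" "1 < m + \<rho>" "-1 < m"
    and \<nu>: "2 * m - \<rho> - 1/2 \<le> 3 * \<nu>" and \<rho>': "\<rho> \<le> \<rho>'"
  shows "pos_series (bessel_integral_coeff m \<nu> \<rho>')"
proof -
  define G where "G = (\<lambda>a k. Gamma (a + real k))"
  \<comment> \<open>The value makes the parameter sums in \<open>q1\<close> agree:
    \<open>3 * \<mu> + 2 = 2 * c + 1/2\<close>. The value of \<open>d\<close> does the same for
    \<open>q2\<close>. There \<open>(m + 1)/2\<close> has to be the least parameter:
    \<open>(m + 1)/2 \<le> \<mu> + 1/2\<close> means \<open>m \<le> 2 * \<rho> + 1\<close>, and
    \<open>(m + 1)/2 \<le> d\<close> means \<open>2 * \<rho> - 2 \<le> m\<close>. The bound on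
    \<open>\<nu>\<close> is \<open>d \<le> \<nu> + 1\<close>.\<close>
  define \<mu> where "\<mu> = (m + \<rho> + 1/2) / 3"
  define c where "c = (m + \<rho> + 2) / 2"
  define c' where "c' = (m + \<rho>' + 2) / 2"
  define d where "d = m - \<mu> + 1"
  have Gp: "0 < G a k" if "0 < a" for a k using that by (auto simp: G_def intro!: Gamma_real_pos)
  have pos: "0 < d" "0 < c" "0 < c'" "1/2 < \<mu>" "d \<le> \<nu> + 1" "c \<le> c'" "-1/2 < m / 2" 
    using assms by (auto simp: d_def \<mu>_def c_def c'_def field_simps)
  define q1 where "q1 = (\<lambda>k. (G (\<mu> + 1) k * G (2 * \<mu> + 1) k) / (G c k * G (c + 1/2) k))"
  define q2 where "q2 = (\<lambda>k. (G ((m+1)/2) k * G ((m+2)/2) k) / (G d k * G (\<mu> + 1/2) k))"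
  define q3 where "q3 = (\<lambda>k. G d k / G (\<nu> + 1) k)"
  define q4 where "q4 = (\<lambda>k. G c k / G c' k)"
  define q5 where "q5 = (\<lambda>k. G (c + 1/2) k / G (c' + 1/2) k)"
  have q1: "pos_multiplier q1"
    unfolding G_def q1_def using assms by (intro pos_multiplier_Gamma_quotient2) (auto simp: c_def \<mu>_def field_simps)
  have q2: "nonneg_multiplier q2" 
    unfolding G_def q2_def using assms
    by (intro nonneg_multiplier_Gamma_quotient2) (auto simp: d_def \<mu>_def field_simps)
  have q3: "nonneg_multiplier q3" and q4: "nonneg_multiplier q4" and q5: "nonneg_multiplier q5"
    unfolding G_def q3_def q4_def q5_def using pos by (intro nonneg_multiplier_Gamma_quotient; simp)+
  have p: "0 < q2 k" "0 < q3 k" "0 < q4 k" "0 < q5 k" for k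
    unfolding q2_def q3_def q4_def q5_def G_def using pos assms
    by (intro Gamma_quotient_pos Gamma_quotient2_pos; simp)+
  have "pos_multiplier (\<lambda>k. q5 k * (q4 k * (q3 k * (q2 k * q1 k))))"
    by (intro pos_multiplier_mult q1 q2 q3 q4 q5 p)
  from pos_series_mult[OF this nonneg_series_bessel_square[of \<mu>]]
  have "pos_series (\<lambda>k. q5 k * (q4 k * (q3 k * (q2 k * q1 k))) * bessel_square_coeff \<mu> k)"
    using pos by simp
  also have "(\<lambda>k. q5 k * (q4 k * (q3 k * (q2 k * q1 k))) * bessel_square_coeff \<mu> k) = bessel_integral_coeff m \<nu> \<rho>'"
  proof
    fix k
    have "bessel_square_coeff \<mu> k = (-1/4) ^ k * G (\<mu> + 1/2) k / (G (\<mu> + 1) k * G (2 * \<mu> + 1) k * fact k)"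
      by (simp add: bessel_square_coeff_def G_def add_divide_distrib)
    moreover have "bessel_integral_coeff m \<nu> \<rho>' k = (-1/4) ^ k * (G ((m+1)/2) k * G ((m+2)/2) k) / (G c' k * G (c' + 1/2) k * G (\<nu> + 1) k * fact k)"
      by (simp add: bessel_integral_coeff_def G_def c'_def add_divide_distrib add_ac)
    moreover have "G d k \<noteq> 0" "G (\<mu> + 1/2) k \<noteq> 0" "G (\<mu> + 1) k \<noteq> 0" "G (2 * \<mu> + 1) k \<noteq> 0" "G c k \<noteq> 0" "G (c + 1/2) k \<noteq> 0"
      by (intro less_imp_neq[symmetric] Gp; use pos in simp)+
    ultimately show "q5 k * (q4 k * (q3 k * (q2 k * q1 k))) * bessel_square_coeff \<mu> k = bessel_integral_coeff m \<nu> \<rho>' k"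
      by (simp add: q1_def q2_def q3_def q4_def q5_def mult_ac)
  qed
  finally show ?thesis .
qed

text \<open>The model case is \<open>m = 0\<close>, \<open>\<rho> = 1\<close>,
  \<open>\<nu> = -1/2\<close>, where up to a constant the integral is that of
  \<open>(1 - u) * cos (u * x)\<close> over \<open>[0, 1]\<close>, that is
  \<open>(1 - cos x) / x\<^sup>2\<close>, the Bessel square of order 1/2. \<open>q1\<close> raises
  \<open>\<nu>\<close> strictly, \<open>q2\<close> and \<open>q3\<close> lower \<open>m\<close>, and
  \<open>q4\<close> and \<open>q5\<close> raise \<open>\<rho>\<close>.\<close>

lemma pos_series_small_m:
  assumes m: "-1 < m" "m \<le> 0" and \<nu>: "-1/2 < \<nu>" and \<rho>: "1 \<le> \<rho>"
  shows "pos_series (bessel_integral_coeff m \<nu> \<rho>)"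
proof -
  define G where "G = (\<lambda>a k. Gamma (a + real k))"
  define c where "c = (m + \<rho> + 2) / 2"
  have Gp: "0 < G a k" if "0 < a" for a k using that by (auto simp: G_def intro!: Gamma_real_pos)
  define q1 where "q1 = (\<lambda>k. G (1/2) k / G (\<nu> + 1) k)"
  define q2 where "q2 = (\<lambda>k. (G ((m+1)/2) k * G (3/2) k) / (G (1/2) k * G ((m+3)/2) k))"
  define q3 where "q3 = (\<lambda>k. (G ((m+2)/2) k * G 2 k) / (G 1 k * G ((m+4)/2) k))"
  define q4 where "q4 = (\<lambda>k. G ((m+3)/2) k / G c k)"
  define q5 where "q5 = (\<lambda>k. G ((m+4)/2) k / G (c + 1/2) k)"
  have q1: "pos_multiplier q1"
    unfolding G_def q1_def using assms by (intro pos_multiplier_Gamma_quotient) auto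
  have q2: "nonneg_multiplier q2" 
    unfolding G_def q2_def using assms by (intro nonneg_multiplier_Gamma_quotient2) (auto simp: field_simps)
  have q3: "nonneg_multiplier q3" 
    unfolding G_def q3_def using assms by (intro nonneg_multiplier_Gamma_quotient2) (auto simp: field_simps)
  have q4: "nonneg_multiplier q4" and q5: "nonneg_multiplier q5"
    unfolding G_def q4_def q5_def using assms by (intro nonneg_multiplier_Gamma_quotient; simp add: c_def)+
  have p: "0 < q2 k" "0 < q3 k" "0 < q4 k" "0 < q5 k" for k
    unfolding q2_def q3_def q4_def q5_def G_def using assms
    by (intro Gamma_quotient_pos Gamma_quotient2_pos; simp add: c_def field_simps)+
  have "pos_multiplier (\<lambda>k. q5 k * (q4 k * (q3 k * (q2 k * q1 k))))"
    by (intro pos_multiplier_mult q1 q2 q3 q4 q5 p)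
  from pos_series_mult[OF this nonneg_series_bessel_square[of "1/2"]]
  have "pos_series (\<lambda>k. q5 k * (q4 k * (q3 k * (q2 k * q1 k))) * bessel_square_coeff (1/2) k)"
    by simp
  also have "(\<lambda>k. q5 k * (q4 k * (q3 k * (q2 k * q1 k))) * bessel_square_coeff (1/2) k) = bessel_integral_coeff m \<nu> \<rho>"
  proof
    fix k
    have "bessel_square_coeff (1/2) k = (-1/4) ^ k * G 1 k / (G (3/2) k * G 2 k * fact k)"
      by (simp add: bessel_square_coeff_def G_def)
    moreover have "bessel_integral_coeff m \<nu> \<rho> k = (-1/4) ^ k * (G ((m+1)/2) k * G ((m+2)/2) k) / (G c k * G (c + 1/2) k * G (\<nu> + 1) k * fact k)"
      by (simp add: bessel_integral_coeff_def G_def c_def add_divide_distrib add_ac)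
    moreover have "G (1/2) k \<noteq> 0" "G 1 k \<noteq> 0" "G (3/2) k \<noteq> 0" "G 2 k \<noteq> 0" "G ((m+3)/2) k \<noteq> 0" "G ((m+4)/2) k \<noteq> 0"
      by (intro less_imp_neq[symmetric] Gp; use assms in simp)+
    ultimately show "q5 k * (q4 k * (q3 k * (q2 k * q1 k))) * bessel_square_coeff (1/2) k = bessel_integral_coeff m \<nu> \<rho> k"
      by (simp add: q1_def q2_def q3_def q4_def q5_def mult_ac)
  qed
  finally show ?thesis .
qed

text \<open>For \<open>m \<le> 0\<close> the sine square is the comparison function. Otherwise each
  of the last three bounds on \<open>\<nu>\<close> governs one range of \<open>m\<close>: the second
  of them large \<open>m\<close>, the third the middle range, and the first the range
  \<open>m \<le> 2 * \<rho> - 2\<close>, where the exponent \<open>m/2 + 1\<close> sits on the lower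
  edge of the middle range.\<close>

theorem pos_series_bessel_integral:
  assumes "-1 < m" "1 \<le> \<rho>" "-1/2 < \<nu>" "(m - 1) / 2 \<le> \<nu>" "m - \<rho> - 1/2 \<le> \<nu>" "2 * m - \<rho> - 1/2 \<le> 3 * \<nu>"
  shows "pos_series (bessel_integral_coeff m \<nu> \<rho>)"
proof -
  consider "m \<le> 0" | "2 * \<rho> + 1 \<le> m" | "0 < m" "2 * \<rho> - 2 \<le> m" "m \<le> 2 * \<rho> + 1" | "0 < m" "m \<le> 2 * \<rho> - 2"
    by linarith
  then show ?thesis
  proof cases
    case 1 then show ?thesis using assms by (intro pos_series_small_m) auto
  next
    case 2 then show ?thesis using assms by (intro pos_series_large_m) auto
  next
    case 3 then show ?thesis using assms by (intro pos_series_medium_m[where \<rho> = \<rho>]) auto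
  next
    case 4 then show ?thesis using assms by (intro pos_series_medium_m[where \<rho> = "m / 2 + 1"]) auto
  qed
qed

section \<open>Gaussian moments and cosine transforms\<close>

text \<open>Once the lower coefficients vanish, \<open>y ^ k\<close> can be divided out, and
  continuity from the right at 0 yields the next one. Values at positive \<open>y\<close> suffice,
  which suits series evaluated at \<open>y = s\<^sup>2\<close>.\<close>

lemma power_series_coeff_zero:
  assumes d: "entire_coeffs d" and z: "\<And>y. 0 < y \<Longrightarrow> (\<Sum>k. d k * y ^ k) = 0"
  shows "d k = 0"
proof (induction k rule: less_induct)
  case (less k)
  have sd: "summable (\<lambda>j. d j * y ^ j)" for y using d by (simp add: entire_coeffs_def)
  define g where "g = (\<lambda>j. d (j + k))"
  have sg: "summable (\<lambda>j. g j * y ^ j)" for y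
  proof (cases "y = 0")
    case True
    then show ?thesis by (intro summable_finite[of "{0}"]) auto
  next
    case False
    have "summable (\<lambda>j. d (j + k) * y ^ (j + k))"
      using sd[of y] by (subst summable_iff_shift)
    then have "summable (\<lambda>j. d (j + k) * y ^ (j + k) * inverse (y ^ k))" by (rule summable_mult2)
    then show ?thesis using False by (simp add: g_def power_add mult.assoc)
  qed
  then have eg: "entire_coeffs g" by (simp add: entire_coeffs_def)
  define G where "G = (\<lambda>y. \<Sum>j. g j * y ^ j)"
  have G0: "G y = 0" if y: "0 < y" for y
  proof -
    have "0 = (\<Sum>j. d (j + k) * y ^ (j + k)) + (\<Sum>j<k. d j * y ^ j)"
      using suminf_split_initial_segment[OF sd[of y], of k] z[OF y] by simp
    also have "(\<Sum>j<k. d j * y ^ j) = 0" using less by simp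
    also have "(\<Sum>j. d (j + k) * y ^ (j + k)) = (\<Sum>j. y ^ k * (g j * y ^ j))"
      by (simp add: g_def power_add mult_ac)
    also have "\<dots> = y ^ k * G y" unfolding G_def by (intro suminf_mult sg)
    finally show ?thesis using y by simp
  qed
  have "continuous_on UNIV G" unfolding G_def by (rule entire_coeffs_continuous[OF eg])
  then have "(G \<longlongrightarrow> G 0) (at_right 0)"
    by (metis UNIV_I continuous_on_def tendsto_mono at_le subset_UNIV)
  moreover have "((\<lambda>_::real. 0) \<longlongrightarrow> G 0) (at_right 0) \<longleftrightarrow> (G \<longlongrightarrow> G 0) (at_right 0)"
    by (rule tendsto_cong, rule eventually_at_rightI[of 0 1]) (auto simp: G0)
  ultimately have "((\<lambda>_. 0) \<longlongrightarrow> G 0) (at_right (0::real))" by simp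
  then have "G 0 = 0" using tendsto_unique[OF _ tendsto_const[of 0]] by (metis trivial_limit_at_right_real)
  then show "d k = 0" using powser_zero[of g] by (simp add: G_def g_def)
qed

lemma nn_integral_gaussian_exp:
  fixes s :: real
  shows "(\<integral>\<^sup>+x. ennreal (exp (s * x - x\<^sup>2)) \<partial>lborel) = ennreal (sqrt pi * exp (s\<^sup>2 / 4))"
proof -
  have "(\<integral>\<^sup>+x. ennreal (normal_density (s / 2) (sqrt (1/2)) x) \<partial>lborel) = ennreal 1"
    by (subst nn_integral_eq_integral) (auto simp: integrable_normal_density integral_normal_density)
  then have "(\<integral>\<^sup>+x. ennreal (sqrt pi * exp (s\<^sup>2 / 4)) * ennreal (normal_density (s / 2) (sqrt (1/2)) x) \<partial>lborel)
    = ennreal (sqrt pi * exp (s\<^sup>2 / 4))"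
    by (subst nn_integral_cmult) auto
  moreover have "ennreal (sqrt pi * exp (s\<^sup>2 / 4)) * ennreal (normal_density (s / 2) (sqrt (1/2)) x)
     = ennreal (exp (s * x - x\<^sup>2))" for x
  proof -
    have "exp (s\<^sup>2 / 4) * exp (- (x - s / 2)\<^sup>2) = exp (s * x - x\<^sup>2)"
      by (simp add: power2_diff power_divide flip: exp_add)
    then show ?thesis by (simp add: normal_density_def flip: ennreal_mult)
  qed
  ultimately show ?thesis by simp
qed

lemma norm_power2_eq_sum: "(norm x)\<^sup>2 = (\<Sum>b\<in>Basis. (x \<bullet> b)\<^sup>2)" for x :: "'a::euclidean_space"
  unfolding power2_norm_eq_inner by (subst euclidean_inner) (simp add: power2_eq_square)

lemma nn_integral_gaussian_exp_inner:
  fixes \<xi> :: "'a::euclidean_space"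
  shows "(\<integral>\<^sup>+x. ennreal (exp (\<xi> \<bullet> x - (norm x)\<^sup>2)) \<partial>lborel) = ennreal (sqrt pi ^ DIM('a) * exp ((norm \<xi>)\<^sup>2 / 4))"
proof -
  have "(\<integral>\<^sup>+x. ennreal (exp (\<xi> \<bullet> x - (norm x)\<^sup>2)) \<partial>lborel) =
      (\<integral>\<^sup>+x. (\<Prod>b\<in>Basis. ennreal (exp ((\<xi> \<bullet> b) * (x \<bullet> b) - (x \<bullet> b)\<^sup>2))) \<partial>lborel)"
  proof (intro nn_integral_cong)
    fix x :: 'a
    have "\<xi> \<bullet> x - (norm x)\<^sup>2 = (\<Sum>b\<in>Basis. (\<xi> \<bullet> b) * (x \<bullet> b) - (x \<bullet> b)\<^sup>2)"
      using euclidean_inner[of \<xi> x] by (simp add: norm_power2_eq_sum sum_subtractf)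
    then show "ennreal (exp (\<xi> \<bullet> x - (norm x)\<^sup>2)) = (\<Prod>b\<in>Basis. ennreal (exp ((\<xi> \<bullet> b) * (x \<bullet> b) - (x \<bullet> b)\<^sup>2)))"
      by (simp add: exp_sum prod_ennreal)
  qed
  also have "\<dots> = (\<Prod>b\<in>Basis. \<integral>\<^sup>+x. ennreal (exp ((\<xi> \<bullet> b) * x - x\<^sup>2)) \<partial>lborel)"
    by (rule nn_integral_lborel_prod) auto
  also have "\<dots> = ennreal (\<Prod>b\<in>(Basis::'a set). sqrt pi * exp ((\<xi> \<bullet> b)\<^sup>2 / 4))"
    by (simp add: nn_integral_gaussian_exp prod_ennreal)
  also have "(\<Prod>b\<in>(Basis::'a set). sqrt pi * exp ((\<xi> \<bullet> b)\<^sup>2 / 4)) = sqrt pi ^ DIM('a) * exp (\<Sum>b\<in>Basis. (\<xi> \<bullet> b)\<^sup>2 / 4)"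
    by (simp add: prod.distrib exp_sum)
  also have "(\<Sum>b\<in>Basis. (\<xi> \<bullet> b)\<^sup>2 / 4) = (norm \<xi>)\<^sup>2 / 4"
    by (simp add: norm_power2_eq_sum flip: sum_divide_distrib)
  finally show ?thesis .
qed

lemma cosh_paired: "(\<lambda>k. x ^ (2 * k) / fact (2 * k)) sums cosh (x::real)"
proof -
  have "(\<lambda>k. (\<lambda>n. if even n then x ^ n /\<^sub>R fact n else 0) (2 * k)) sums cosh x"
    by (subst sums_mono_reindex) (auto simp: strict_mono_def cosh_converges)
  then show ?thesis by (simp add: field_simps)
qed

lemma nn_integral_lborel_scale:
  fixes f :: "'a::euclidean_space \<Rightarrow> ennreal"
  assumes [measurable]: "f \<in> borel_measurable borel" and c: "0 < c"
  shows "(\<integral>\<^sup>+x. f x \<partial>lborel) = ennreal (c ^ DIM('a)) * (\<integral>\<^sup>+x. f (t + c *\<^sub>R x) \<partial>lborel)"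
  using c by (subst lborel_affine[of c t]) (simp_all add: nn_integral_density nn_integral_distr nn_integral_cmult ennreal_power)

text \<open>The moments are read off the generating function obtained by integrating
  \<open>cosh (s * (\<xi> \<bullet> x))\<close> against the Gaussian. Only even powers occur, so all
  terms are nonnegative and sum and integral may be exchanged at once.\<close>

lemma nn_integral_gaussian_moment:
  fixes \<xi> :: "'a::euclidean_space"
  shows "(\<integral>\<^sup>+x. ennreal ((\<xi> \<bullet> x) ^ (2 * k) * exp (- (norm x)\<^sup>2)) \<partial>lborel) =
    ennreal (sqrt pi ^ DIM('a) * fact (2 * k) / (4 ^ k * fact k) * norm \<xi> ^ (2 * k))"
proof -
  define M where "M = (\<lambda>k. \<integral>\<^sup>+x. ennreal ((\<xi> \<bullet> x) ^ (2 * k) * exp (- (norm x)\<^sup>2)) \<partial>lborel)"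
  define P where "P = sqrt pi ^ DIM('a)"
  have P: "P > 0" by (simp add: P_def)
  have nn: "0 \<le> (\<xi> \<bullet> x) ^ (2 * k)" for x k by simp
  have half: "ennreal (1/2) * (ennreal a + ennreal b) = ennreal (1/2 * (a + b))" if "0 \<le> a" "0 \<le> b" for a b
    using that by (subst ennreal_plus[symmetric], simp, simp, subst ennreal_mult[symmetric]) auto
  have cosh: "(\<Sum>k. ennreal (s ^ (2 * k) / fact (2 * k)) * M k) = ennreal (P * exp (s\<^sup>2 * (norm \<xi>)\<^sup>2 / 4))" for s :: real
  proof -
    have "(\<Sum>k. ennreal (s ^ (2 * k) / fact (2 * k)) * M k) =
       (\<Sum>k. \<integral>\<^sup>+x. ennreal (s ^ (2 * k) / fact (2 * k)) * ennreal ((\<xi> \<bullet> x) ^ (2 * k) * exp (- (norm x)\<^sup>2)) \<partial>lborel)"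
      unfolding M_def by (subst nn_integral_cmult) auto
    also have "\<dots> = (\<integral>\<^sup>+x. (\<Sum>k. ennreal (s ^ (2 * k) / fact (2 * k)) * ennreal ((\<xi> \<bullet> x) ^ (2 * k) * exp (- (norm x)\<^sup>2))) \<partial>lborel)"
      by (rule nn_integral_suminf[symmetric]) auto
    also have "\<dots> = (\<integral>\<^sup>+x. ennreal (1/2) * (ennreal (exp ((s *\<^sub>R \<xi>) \<bullet> x - (norm x)\<^sup>2)) + ennreal (exp ((- s *\<^sub>R \<xi>) \<bullet> x - (norm x)\<^sup>2))) \<partial>lborel)"
    proof (intro nn_integral_cong)
      fix x
      have "(\<Sum>k. ennreal (s ^ (2 * k) / fact (2 * k)) * ennreal ((\<xi> \<bullet> x) ^ (2 * k) * exp (- (norm x)\<^sup>2)))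
        = (\<Sum>k. ennreal ((s * (\<xi> \<bullet> x)) ^ (2 * k) / fact (2 * k) * exp (- (norm x)\<^sup>2)))"
        by (intro suminf_cong, subst ennreal_mult[symmetric]) (auto simp: power_mult_distrib)
      also have "\<dots> = ennreal (cosh (s * (\<xi> \<bullet> x)) * exp (- (norm x)\<^sup>2))"
        using sums_mult2[OF cosh_paired[of "s * (\<xi> \<bullet> x)"], of "exp (- (norm x)\<^sup>2)"]
        by (intro suminf_ennreal_eq) auto
      also have "cosh (s * (\<xi> \<bullet> x)) * exp (- (norm x)\<^sup>2) = (1/2) * (exp ((s *\<^sub>R \<xi>) \<bullet> x - (norm x)\<^sup>2) + exp ((- s *\<^sub>R \<xi>) \<bullet> x - (norm x)\<^sup>2))"
        by (simp add: cosh_def exp_diff exp_minus field_simps)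
      finally show "(\<Sum>k. ennreal (s ^ (2 * k) / fact (2 * k)) * ennreal ((\<xi> \<bullet> x) ^ (2 * k) * exp (- (norm x)\<^sup>2)))
        = ennreal (1/2) * (ennreal (exp ((s *\<^sub>R \<xi>) \<bullet> x - (norm x)\<^sup>2)) + ennreal (exp ((- s *\<^sub>R \<xi>) \<bullet> x - (norm x)\<^sup>2)))"
        by (simp only: half exp_ge_zero)
    qed
    also have "\<dots> = ennreal (1/2) * (ennreal (P * exp ((norm (s *\<^sub>R \<xi>))\<^sup>2 / 4)) + ennreal (P * exp ((norm (- s *\<^sub>R \<xi>))\<^sup>2 / 4)))"
      unfolding P_def nn_integral_gaussian_exp_inner[symmetric]
      by (subst nn_integral_cmult, simp, subst nn_integral_add) auto
    also have "\<dots> = ennreal (1/2 * (P * exp (s\<^sup>2 * (norm \<xi>)\<^sup>2 / 4) + P * exp (s\<^sup>2 * (norm \<xi>)\<^sup>2 / 4)))"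
    proof -
      have nrm: "(norm (s *\<^sub>R \<xi>))\<^sup>2 = s\<^sup>2 * (norm \<xi>)\<^sup>2" "(norm (- s *\<^sub>R \<xi>))\<^sup>2 = s\<^sup>2 * (norm \<xi>)\<^sup>2"
        by (simp_all add: power_mult_distrib)
      show ?thesis unfolding nrm by (rule half) (use P in auto)
    qed
    finally show ?thesis by simp
  qed
  \<comment> \<open>Each term of the generating series at \<open>s = 1\<close> is below its finite
    sum; after this the comparison of coefficients takes place in the reals.\<close>
  have fin: "M k < top" for k
  proof -
    have "ennreal (1 / fact (2 * k)) * M k \<le> (\<Sum>j. ennreal (1 ^ (2 * j) / fact (2 * j)) * M j)"
      using sum_le_suminf[of "\<lambda>j. ennreal (1 ^ (2 * j) / fact (2 * j)) * M j" "{k}"] by simp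
    also have "\<dots> < top" unfolding cosh by simp
    finally show ?thesis by (auto simp: ennreal_mult_less_top less_top)
  qed
  define \<mu> where "\<mu> = (\<lambda>k. enn2real (M k))"
  have M\<mu>: "M k = ennreal (\<mu> k)" and \<mu>0: "0 \<le> \<mu> k" for k using fin[of k] by (auto simp: \<mu>_def)
  have sm: "(\<lambda>k. \<mu> k / fact (2 * k) * y ^ k) sums (P * exp (y * (norm \<xi>)\<^sup>2 / 4))" if y: "0 \<le> y" for y
  proof -
    have "(sqrt y ^ k)\<^sup>2 = y ^ k" for k
      using y by (metis power_mult mult.commute real_sqrt_pow2)
    then have "(\<Sum>k. ennreal (\<mu> k / fact (2 * k) * y ^ k)) = ennreal (P * exp (y * (norm \<xi>)\<^sup>2 / 4))"
      using cosh[of "sqrt y"] y \<mu>0 by (simp add: M\<mu> power_mult ennreal_mult[symmetric] mult_ac)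
    then have "(\<lambda>k. ennreal (\<mu> k / fact (2 * k) * y ^ k)) sums ennreal (P * exp (y * (norm \<xi>)\<^sup>2 / 4))"
      by (metis summableI summable_sums)
    then show ?thesis using \<mu>0 y P by (subst (asm) sums_ennreal) auto
  qed
  have e1: "entire_coeffs (\<lambda>k. \<mu> k / fact (2 * k))"
    unfolding entire_coeffs_def
  proof
    fix y
    have "summable (\<lambda>k. norm (\<mu> k / fact (2 * k) * y ^ k))"
      using sums_summable[OF sm[of "\<bar>y\<bar>"]] \<mu>0 by (simp add: abs_mult power_abs)
    then show "summable (\<lambda>k. \<mu> k / fact (2 * k) * y ^ k)" by (rule summable_norm_cancel)
  qed
  have sm2: "(\<lambda>k. P * (((norm \<xi>)\<^sup>2 / 4) ^ k / fact k) * y ^ k) sums (P * exp (y * (norm \<xi>)\<^sup>2 / 4))" for y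
    using sums_mult[OF exp_converges[of "y * (norm \<xi>)\<^sup>2 / 4"], of P]
    by (simp add: power_mult_distrib power_divide field_simps)
  have "\<mu> k / fact (2 * k) - P * (((norm \<xi>)\<^sup>2 / 4) ^ k / fact k) = 0"
  proof (rule power_series_coeff_zero[of "\<lambda>k. \<mu> k / fact (2 * k) - P * (((norm \<xi>)\<^sup>2 / 4) ^ k / fact k)"])
    have s: "summable (\<lambda>k. (\<mu> k / fact (2 * k) - P * (((norm \<xi>)\<^sup>2 / 4) ^ k / fact k)) * y ^ k)" for y
      using e1 sums_summable[OF sm2[of y]] unfolding left_diff_distrib by (intro summable_diff) (auto simp: entire_coeffs_def)
    then show "entire_coeffs (\<lambda>k. \<mu> k / fact (2 * k) - P * (((norm \<xi>)\<^sup>2 / 4) ^ k / fact k))"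
      by (simp add: entire_coeffs_def)
    fix y :: real assume "0 < y"
    then have "(\<lambda>k. (\<mu> k / fact (2 * k) - P * (((norm \<xi>)\<^sup>2 / 4) ^ k / fact k)) * y ^ k) sums 0"
      using sums_diff[OF sm[of y] sm2[of y]] unfolding left_diff_distrib by simp
    then show "(\<Sum>k. (\<mu> k / fact (2 * k) - P * (((norm \<xi>)\<^sup>2 / 4) ^ k / fact k)) * y ^ k) = 0"
      by (simp add: sums_iff)
  qed
  then have "\<mu> k = P * fact (2 * k) / (4 ^ k * fact k) * norm \<xi> ^ (2 * k)"
    by (simp add: field_simps power_divide flip: power_mult)
  then show ?thesis using M\<mu>[of k] by (simp add: M_def P_def)
qed

text \<open>Expand the cosine and integrate term by term. The \<open>k\<close>-th term has absolute
  integral \<open>e k\<close>, since the factorial in the moment cancels that of the cosine series,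
  so summability of \<open>e\<close> justifies the exchange.\<close>

lemma cos_transform_moments:
  fixes w :: "'a::euclidean_space \<Rightarrow> real"
  assumes w: "w \<in> borel_measurable borel" "\<And>x. 0 \<le> w x"
    and mom: "\<And>k. (\<integral>\<^sup>+x. ennreal (w x * (\<xi> \<bullet> x) ^ (2 * k)) \<partial>lborel) = ennreal (fact (2 * k) * e k)"
    and e: "\<And>k. 0 \<le> e k" "summable e"
  shows "integrable lborel w" "(\<integral>x. w x * cos (\<xi> \<bullet> x) \<partial>lborel) = (\<Sum>k. (-1) ^ k * e k)"
proof -
  note [measurable] = w(1)
  have i: "has_bochner_integral lborel (\<lambda>x. w x * (\<xi> \<bullet> x) ^ (2 * k)) (fact (2 * k) * e k)" for k
    using w e mom[of k] by (intro has_bochner_integral_nn_integral) auto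
  from i[of 0] show "integrable lborel w" by (simp add: has_bochner_integral_iff)
  define f where "f = (\<lambda>k x. w x * ((-1) ^ k / fact (2 * k) * (\<xi> \<bullet> x) ^ (2 * k)))"
  have fi: "integrable lborel (f k)" "integral\<^sup>L lborel (f k) = (-1) ^ k * e k" for k
    using has_bochner_integral_mult_right[OF i[of k], of "(-1) ^ k / fact (2 * k)"]
    by (simp_all add: f_def has_bochner_integral_iff mult_ac)
  have "norm (f k x) = 1 / fact (2 * k) * (w x * (\<xi> \<bullet> x) ^ (2 * k))" for k x
    using w(2)[of x] by (simp add: f_def abs_mult)
  then have fn: "(\<integral>x. norm (f k x) \<partial>lborel) = e k" for k
    using has_bochner_integral_mult_right[OF i[of k], of "1 / fact (2 * k)"]
    by (simp add: has_bochner_integral_iff)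
  have "(\<integral>x. w x * cos (\<xi> \<bullet> x) \<partial>lborel) = (\<integral>x. (\<Sum>k. f k x) \<partial>lborel)"
    using sums_mult[OF cos_paired] by (intro Bochner_Integration.integral_cong refl) (simp add: f_def sums_iff)
  also have "\<dots> = (\<Sum>k. integral\<^sup>L lborel (f k))"
  proof (rule integral_suminf[OF fi(1)])
    show "AE x in lborel. summable (\<lambda>k. norm (f k x))"
    proof (rule AE_I2)
      fix x
      have "summable (\<lambda>k. w x * ((\<xi> \<bullet> x) ^ (2 * k) / fact (2 * k)))"
        using sums_mult[OF cosh_paired] by (auto simp: sums_iff)
      then show "summable (\<lambda>k. norm (f k x))" using w(2)[of x] by (simp add: f_def abs_mult)
    qed
    show "summable (\<lambda>k. \<integral>x. norm (f k x) \<partial>lborel)" using e fn by simp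
  qed
  finally show "(\<integral>x. w x * cos (\<xi> \<bullet> x) \<partial>lborel) = (\<Sum>k. (-1) ^ k * e k)" using fi by simp
qed

section \<open>Even functions: from Fourier to cosine transforms\<close>

lemma integral_lborel_uminus:
  fixes f :: "'a::euclidean_space \<Rightarrow> real"
  assumes [measurable]: "f \<in> borel_measurable borel"
  shows "(\<integral>x. f (- x) \<partial>lborel) = (\<integral>x. f x \<partial>lborel)"
proof -
  have "lborel = distr lborel borel (uminus :: 'a \<Rightarrow> 'a)"
    using lborel_affine[of "-1" "0::'a"] by (simp add: density_1)
  then have "integral\<^sup>L lborel f = integral\<^sup>L (distr lborel borel uminus) f" by (rule arg_cong)
  also have "\<dots> = (\<integral>x. f (- x) \<partial>lborel)" by (rule integral_distr) auto
  finally show ?thesis ..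
qed

lemma integral_even_sin:
  fixes w :: "'a::euclidean_space \<Rightarrow> real"
  assumes [measurable]: "w \<in> borel_measurable borel" and even: "\<And>x. w (- x) = w x"
  shows "(\<integral>x. w x * sin (\<xi> \<bullet> x) \<partial>lborel) = 0"
  using integral_lborel_uminus[of "\<lambda>x. w x * sin (\<xi> \<bullet> x)"] by (simp add: even)

lemma integrable_mult_bounded:
  fixes w g :: "'a::euclidean_space \<Rightarrow> real"
  assumes w: "integrable lborel w" and [measurable]: "g \<in> borel_measurable borel" and g: "\<And>x. \<bar>g x\<bar> \<le> 1"
  shows "integrable lborel (\<lambda>x. w x * g x)"
proof -
  have [measurable]: "w \<in> borel_measurable borel" using w by auto
  show ?thesis
  by (rule Bochner_Integration.integrable_bound[OF w]) (auto simp: abs_mult mult_left_le g)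
qed

lemma fourier_even:
  fixes w :: "'a::euclidean_space \<Rightarrow> real"
  assumes w: "integrable lborel w" and even: "\<And>x. w (- x) = w x"
  shows "fourier w \<xi> = complex_of_real (\<integral>x. w x * cos (\<xi> \<bullet> x) \<partial>lborel)"
proof -
  have [measurable]: "w \<in> borel_measurable borel" using w by auto
  have i: "integrable lborel (\<lambda>x. w x * cos (\<xi> \<bullet> x))" "integrable lborel (\<lambda>x. w x * sin (\<xi> \<bullet> x))"
    by (intro integrable_mult_bounded w; auto)+
  have "fourier w \<xi> = (\<integral>x. complex_of_real (w x * cos (\<xi> \<bullet> x)) - \<i> * complex_of_real (w x * sin (\<xi> \<bullet> x)) \<partial>lborel)"
    unfolding fourier_def
  proof (intro Bochner_Integration.integral_cong refl)
    fix x
    have "exp (- (\<i> * complex_of_real t)) = complex_of_real (cos t) - \<i> * complex_of_real (sin t)" for t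
      by (simp add: exp_minus_Euler cos_of_real sin_of_real)
    then show "complex_of_real (w x) * exp (- (\<i> * complex_of_real (\<xi> \<bullet> x))) =
        complex_of_real (w x * cos (\<xi> \<bullet> x)) - \<i> * complex_of_real (w x * sin (\<xi> \<bullet> x))"
      by (simp add: right_diff_distrib)
  qed
  also have "\<dots> = (\<integral>x. complex_of_real (w x * cos (\<xi> \<bullet> x)) \<partial>lborel) -
      (\<integral>x. \<i> * complex_of_real (w x * sin (\<xi> \<bullet> x)) \<partial>lborel)"
    by (rule Bochner_Integration.integral_diff[OF integrable_of_real[OF i(1)]
      integrable_mult_right[OF integrable_of_real[OF i(2)]]])
  also have "(\<integral>x. complex_of_real (w x * cos (\<xi> \<bullet> x)) \<partial>lborel) = complex_of_real (\<integral>x. w x * cos (\<xi> \<bullet> x) \<partial>lborel)"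
    by (rule integral_complex_of_real)
  also have "(\<integral>x. \<i> * complex_of_real (w x * sin (\<xi> \<bullet> x)) \<partial>lborel) = \<i> * complex_of_real (\<integral>x. w x * sin (\<xi> \<bullet> x) \<partial>lborel)"
    unfolding integral_mult_right_zero integral_complex_of_real ..
  also have "(\<integral>x. w x * sin (\<xi> \<bullet> x) \<partial>lborel) = 0"
    by (rule integral_even_sin) (simp_all add: even)
  finally show ?thesis by simp
qed

lemma integral_gaussian_cos:
  fixes z :: "'a::euclidean_space"
  shows "(\<integral>x. exp (- (norm x)\<^sup>2) * cos (z \<bullet> x) \<partial>lborel) = sqrt pi ^ DIM('a) * exp (- (norm z)\<^sup>2 / 4)" (is ?th1)
    and "integrable lborel (\<lambda>x::'a. exp (- (norm x)\<^sup>2))"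
proof -
  define q where "q = (norm z)\<^sup>2 / 4"
  define e where "e = (\<lambda>k. sqrt pi ^ DIM('a) * (q ^ k / fact k))"
  have ex: "(\<lambda>k. sqrt pi ^ DIM('a) * (c ^ k / fact k)) sums (sqrt pi ^ DIM('a) * exp c)" for c :: real
    using sums_mult[OF exp_converges[of c]] by (simp add: divide_inverse_commute)
  have e: "0 \<le> e k" "summable e" for k
    using sums_summable[OF ex[of q]] by (simp_all add: e_def q_def)
  have m: "(\<integral>\<^sup>+x. ennreal (exp (- (norm x)\<^sup>2) * (z \<bullet> x) ^ (2 * k)) \<partial>lborel) = ennreal (fact (2 * k) * e k)" for k
  proof -
    have "norm z ^ (2 * k) = 4 ^ k * q ^ k" by (simp add: q_def power_mult flip: power_mult_distrib)
    then show ?thesis using nn_integral_gaussian_moment[of z k] by (simp add: e_def mult_ac)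
  qed
  have "(- 1) ^ k * e k = sqrt pi ^ DIM('a) * ((- q) ^ k / fact k)" for k
    unfolding e_def using power_minus[of q k] by simp
  then have "(\<lambda>k. (- 1) ^ k * e k) sums (sqrt pi ^ DIM('a) * exp (- (norm z)\<^sup>2 / 4))" 
    using ex[of "- q"] by (simp add: q_def)
  then show ?th1 using cos_transform_moments(2)[OF _ _ m e] by (simp add: sums_iff)
  show "integrable lborel (\<lambda>x::'a. exp (- (norm x)\<^sup>2))" using cos_transform_moments(1)[OF _ _ m e] by simp
qed

section \<open>The Fourier transform of W\<close>

lemma pos_powr_nonneg [simp]: "0 \<le> pos_powr s p"
  by (simp add: pos_powr_def)

lemma measurable_pos_powr [measurable (raw)]:
  assumes [measurable]: "f \<in> borel_measurable M"
  shows "(\<lambda>x. pos_powr (f x) p) \<in> borel_measurable M"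
  unfolding pos_powr_def by measurable

lemma pos_powr_mult_left: "0 < t \<Longrightarrow> pos_powr (t * s) p = t powr p * pos_powr s p"
  by (auto simp: pos_powr_def powr_mult zero_less_mult_iff)

lemma measurable_W [measurable]: "(W l \<alpha> \<rho> :: 'a::euclidean_space \<Rightarrow> ennreal) \<in> borel_measurable borel"
  unfolding W_def[abs_def] by measurable

lemma nn_integral_ball_power_scale:
  fixes \<xi> :: "'a::euclidean_space"
  assumes t: "0 < t"
  shows "(\<integral>\<^sup>+x. ennreal (pos_powr (1 - (norm x)\<^sup>2 / t) l * (\<xi> \<bullet> x) ^ (2 * k)) \<partial>lborel) =
    ennreal (t powr (DIM('a) / 2 + k)) * (\<integral>\<^sup>+x. ennreal (pos_powr (1 - (norm x)\<^sup>2) l * (\<xi> \<bullet> x) ^ (2 * k)) \<partial>lborel)"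
proof -
  have "(\<integral>\<^sup>+x. ennreal (pos_powr (1 - (norm x)\<^sup>2 / t) l * (\<xi> \<bullet> x) ^ (2 * k)) \<partial>lborel) =
    ennreal (sqrt t ^ DIM('a)) * (\<integral>\<^sup>+x. ennreal (pos_powr (1 - (norm (0 + sqrt t *\<^sub>R x))\<^sup>2 / t) l * (\<xi> \<bullet> (0 + sqrt t *\<^sub>R x)) ^ (2 * k)) \<partial>lborel)"
    using t by (intro nn_integral_lborel_scale) auto
  also have "\<dots> = ennreal (sqrt t ^ DIM('a)) * (\<integral>\<^sup>+x. ennreal (t ^ k) * ennreal (pos_powr (1 - (norm x)\<^sup>2) l * (\<xi> \<bullet> x) ^ (2 * k)) \<partial>lborel)"
  proof (intro arg_cong[where f = "\<lambda>z. _ * z"] nn_integral_cong)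
    fix x :: 'a
    have "sqrt t ^ (2 * k) = t ^ k" using t by (metis power_mult real_sqrt_pow2 less_imp_le)
    then have "(\<xi> \<bullet> (0 + sqrt t *\<^sub>R x)) ^ (2 * k) = t ^ k * (\<xi> \<bullet> x) ^ (2 * k)"
      by (simp add: power_mult_distrib)
    moreover have "(norm (0 + sqrt t *\<^sub>R x))\<^sup>2 / t = (norm x)\<^sup>2" using t by (simp add: power_mult_distrib)
    ultimately show "ennreal (pos_powr (1 - (norm (0 + sqrt t *\<^sub>R x))\<^sup>2 / t) l * (\<xi> \<bullet> (0 + sqrt t *\<^sub>R x)) ^ (2 * k))
       = ennreal (t ^ k) * ennreal (pos_powr (1 - (norm x)\<^sup>2) l * (\<xi> \<bullet> x) ^ (2 * k))"
      using t by (subst ennreal_mult[symmetric]) (auto simp: mult_ac zero_le_power_eq)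
  qed
  also have "\<dots> = ennreal (sqrt t ^ DIM('a)) * (ennreal (t ^ k) * (\<integral>\<^sup>+x. ennreal (pos_powr (1 - (norm x)\<^sup>2) l * (\<xi> \<bullet> x) ^ (2 * k)) \<partial>lborel))"
    by (subst nn_integral_cmult) auto
  also have "\<dots> = ennreal (sqrt t ^ DIM('a) * t ^ k) * (\<integral>\<^sup>+x. ennreal (pos_powr (1 - (norm x)\<^sup>2) l * (\<xi> \<bullet> x) ^ (2 * k)) \<partial>lborel)"
    using t by (subst ennreal_mult) (auto simp: mult.assoc)
  also have "sqrt t ^ DIM('a) * t ^ k = t powr (DIM('a) / 2 + k)"
    using t by (simp add: powr_add powr_realpow powr_half_sqrt[symmetric] powr_power)
  finally show ?thesis .
qed

lemma nn_integral_exp_pos_powr: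
  assumes l: "-1 < l" and a: "0 \<le> a"
  shows "(\<integral>\<^sup>+t. ennreal (exp (- t) * pos_powr (t - a) l) \<partial>lborel) = ennreal (exp (- a) * Gamma (l + 1))"
proof -
  have "(\<integral>\<^sup>+t. ennreal (exp (- t) * pos_powr (t - a) l) \<partial>lborel) =
    ennreal \<bar>1\<bar> * (\<integral>\<^sup>+t. ennreal (exp (- (a + 1 * t)) * pos_powr ((a + 1 * t) - a) l) \<partial>lborel)"
    by (rule nn_integral_real_affine) auto
  also have "\<dots> = (\<integral>\<^sup>+t. ennreal (exp (- a)) * ennreal (indicator {0..} t * t powr (l + 1 - 1) / exp t) \<partial>lborel)"
    by (simp, intro nn_integral_cong, subst ennreal_mult[symmetric])
      (auto simp: pos_powr_def exp_diff exp_minus field_simps indicator_def)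
  also have "\<dots> = ennreal (exp (- a)) * ennreal (Gamma (l + 1))"
    using l by (subst nn_integral_cmult) (auto simp: Gamma_conv_nn_integral_real)
  finally show ?thesis using l Gamma_real_pos[of "l + 1"] by (simp add: ennreal_mult)
qed

text \<open>The unit ball moments follow from the Gaussian moments by integrating over the radius
  against \<open>exp (- t)\<close>.\<close>

lemma nn_integral_ball_power_moment:
  fixes \<xi> :: "'a::euclidean_space"
  assumes l: "-1 < l"
  shows "(\<integral>\<^sup>+x. ennreal (pos_powr (1 - (norm x)\<^sup>2) l * (\<xi> \<bullet> x) ^ (2 * k)) \<partial>lborel) =
    ennreal (Gamma (l + 1) / Gamma (l + DIM('a) / 2 + 1 + k) *
      (sqrt pi ^ DIM('a) * fact (2 * k) / (4 ^ k * fact k) * norm \<xi> ^ (2 * k)))"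
proof -
  define M where "M = (\<integral>\<^sup>+x. ennreal (pos_powr (1 - (norm x)\<^sup>2) l * (\<xi> \<bullet> x) ^ (2 * k)) \<partial>lborel)"
  define s where "s = l + DIM('a) / 2 + 1 + k"
  define g where "g = sqrt pi ^ DIM('a) * fact (2 * k) / (4 ^ k * fact k) * norm \<xi> ^ (2 * k)"
  have s: "0 < s" using l by (simp add: s_def)
  have G: "0 < Gamma s" "0 < Gamma (l + 1)" using s l by (auto intro!: Gamma_real_pos)
  have g: "0 \<le> g" by (simp add: g_def)
  \<comment> \<open>The value of \<open>s\<close> is chosen so that \<open>t powr (s - 1)\<close> is
    \<open>t powr l * t powr (DIM('a)/2 + k)\<close>. The second factor is the scaling of the moment
    for the ball of radius \<open>sqrt t\<close>; the first turns
    \<open>1 - (norm x)\<^sup>2 / t\<close> into \<open>t - (norm x)\<^sup>2\<close>.\<close>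
  have "ennreal (Gamma s) * M = (\<integral>\<^sup>+t. ennreal (indicator {0..} t * t powr (s - 1) / exp t) * M \<partial>lborel)"
    using s by (subst nn_integral_multc) (auto simp: Gamma_conv_nn_integral_real)
  also have "\<dots> = (\<integral>\<^sup>+t. \<integral>\<^sup>+x. ennreal (exp (- t) * pos_powr (t - (norm x)\<^sup>2) l * (\<xi> \<bullet> x) ^ (2 * k)) \<partial>lborel \<partial>lborel)"
  proof (intro nn_integral_cong)
    fix t :: real
    show "ennreal (indicator {0..} t * t powr (s - 1) / exp t) * M =
      (\<integral>\<^sup>+x. ennreal (exp (- t) * pos_powr (t - (norm x)\<^sup>2) l * (\<xi> \<bullet> x) ^ (2 * k)) \<partial>lborel)"
    proof (cases "0 < t")
      case True
      have "(\<integral>\<^sup>+x. ennreal (exp (- t) * pos_powr (t - (norm x)\<^sup>2) l * (\<xi> \<bullet> x) ^ (2 * k)) \<partial>lborel)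
        = (\<integral>\<^sup>+x. ennreal (exp (- t) * t powr l) * ennreal (pos_powr (1 - (norm x)\<^sup>2 / t) l * (\<xi> \<bullet> x) ^ (2 * k)) \<partial>lborel)"
      proof (intro nn_integral_cong)
        fix x :: 'a
        have "pos_powr (t - (norm x)\<^sup>2) l = t powr l * pos_powr (1 - (norm x)\<^sup>2 / t) l"
          using pos_powr_mult_left[OF True, of "1 - (norm x)\<^sup>2 / t" l] True by (simp add: right_diff_distrib)
        then show "ennreal (exp (- t) * pos_powr (t - (norm x)\<^sup>2) l * (\<xi> \<bullet> x) ^ (2 * k))
           = ennreal (exp (- t) * t powr l) * ennreal (pos_powr (1 - (norm x)\<^sup>2 / t) l * (\<xi> \<bullet> x) ^ (2 * k))"
          by (subst ennreal_mult[symmetric]) (auto simp: mult_ac zero_le_power_eq)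
      qed
      also have "\<dots> = ennreal (exp (- t) * t powr l) * (ennreal (t powr (DIM('a) / 2 + k)) * M)"
        by (subst nn_integral_cmult) (auto simp: nn_integral_ball_power_scale[OF True] M_def)
      also have "\<dots> = ennreal (exp (- t) * t powr l * t powr (DIM('a) / 2 + k)) * M"
        by (subst ennreal_mult) (auto simp: mult.assoc)
      also have "exp (- t) * t powr l * t powr (DIM('a) / 2 + k) = indicator {0..} t * t powr (s - 1) / exp t"
      proof -
        have "s - 1 = l + (DIM('a) / 2 + k)" by (simp add: s_def)
        then have "t powr (s - 1) = t powr l * t powr (DIM('a) / 2 + k)" by (metis powr_add)
        then have "exp (- t) * t powr l * t powr (DIM('a) / 2 + k) = exp (- t) * t powr (s - 1)"
          by (simp only: mult.assoc)
        also have "\<dots> = t powr (s - 1) / exp t"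
          unfolding exp_minus divide_inverse by (rule mult.commute)
        finally show ?thesis using True by (simp only: indicator_simps atLeast_iff less_imp_le mult_1)
      qed
      finally show ?thesis by simp
    next
      case False
      then have "pos_powr (t - (norm x)\<^sup>2) l = 0" for x :: 'a
        using False order.trans[OF _ zero_le_power2, of t "norm x"] by (auto simp: pos_powr_def)
      moreover have "indicator {0..} t * t powr (s - 1) = 0" using False by (auto simp: indicator_def)
      ultimately show ?thesis by simp
    qed
  qed
  also have "\<dots> = (\<integral>\<^sup>+x. \<integral>\<^sup>+t. ennreal (exp (- t) * pos_powr (t - (norm x)\<^sup>2) l * (\<xi> \<bullet> x) ^ (2 * k)) \<partial>lborel \<partial>lborel)"
    by (rule lborel_pair.Fubini') measurable
  also have "\<dots> = (\<integral>\<^sup>+x. ennreal (Gamma (l + 1)) * ennreal ((\<xi> \<bullet> x) ^ (2 * k) * exp (- (norm x)\<^sup>2)) \<partial>lborel)"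
  proof (intro nn_integral_cong)
    fix x :: 'a
    have "(\<integral>\<^sup>+t. ennreal (exp (- t) * pos_powr (t - (norm x)\<^sup>2) l * (\<xi> \<bullet> x) ^ (2 * k)) \<partial>lborel) =
       (\<integral>\<^sup>+t. ennreal (exp (- t) * pos_powr (t - (norm x)\<^sup>2) l) * ennreal ((\<xi> \<bullet> x) ^ (2 * k)) \<partial>lborel)"
      by (intro nn_integral_cong ennreal_mult) auto
    also have "\<dots> = ennreal (exp (- (norm x)\<^sup>2) * Gamma (l + 1)) * ennreal ((\<xi> \<bullet> x) ^ (2 * k))"
      by (subst nn_integral_multc) (auto simp: nn_integral_exp_pos_powr[OF l])
    also have "\<dots> = ennreal (Gamma (l + 1)) * ennreal ((\<xi> \<bullet> x) ^ (2 * k) * exp (- (norm x)\<^sup>2))"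
      using G by (subst (1 2) ennreal_mult[symmetric]) (auto simp: mult_ac zero_le_power_eq)
    finally show "(\<integral>\<^sup>+t. ennreal (exp (- t) * pos_powr (t - (norm x)\<^sup>2) l * (\<xi> \<bullet> x) ^ (2 * k)) \<partial>lborel) =
       ennreal (Gamma (l + 1)) * ennreal ((\<xi> \<bullet> x) ^ (2 * k) * exp (- (norm x)\<^sup>2))" .
  qed
  also have "\<dots> = ennreal (Gamma (l + 1)) * ennreal g"
    by (subst nn_integral_cmult) (auto simp: nn_integral_gaussian_moment g_def)
  also have "\<dots> = ennreal (Gamma s) * ennreal (Gamma (l + 1) / Gamma s * g)"
    using G g by (simp flip: ennreal_mult)
  finally have "ennreal (Gamma s) * M = ennreal (Gamma s) * ennreal (Gamma (l + 1) / Gamma s * g)" .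
  then have "M = ennreal (Gamma (l + 1) / Gamma s * g)"
    using G by (subst (asm) ennreal_mult_cancel_left) auto
  then show ?thesis by (simp add: M_def s_def g_def)
qed

text \<open>Substitute \<open>t = u\<^sup>2\<close>, which turns the integrand into twice that of a
  Beta integral. The integrand vanishes beyond 1, so the range can be cut to
  \<open>{0\<^sup>2..1\<^sup>2}\<close>, the form in which the substitution rule applies.\<close>

lemma nn_integral_Beta_sqrt:
  assumes s: "-1 < s" and \<rho>: "-1 < \<rho>"
  shows "(\<integral>\<^sup>+t\<in>{0<..}. ennreal (t powr s * pos_powr (1 - t powr (1/2)) \<rho>) \<partial>lborel) = ennreal (2 * Beta (2 * s + 2) (\<rho> + 1))"
proof -
  define f where "f = (\<lambda>t. t powr s * pos_powr (1 - t powr (1/2)) \<rho>)"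
  have [measurable]: "f \<in> borel_measurable borel" unfolding f_def by measurable
  have "(\<integral>\<^sup>+t\<in>{0<..}. ennreal (f t) \<partial>lborel) = (\<integral>\<^sup>+t. f t * indicator {(0::real)\<^sup>2..1\<^sup>2} t \<partial>lborel)"
  proof (intro nn_integral_cong)
    fix t :: real
    have "f t = 0" if "1 < t"
      using that ge_one_powr_ge_zero[of t "1/2"] by (auto simp: f_def pos_powr_def)
    then show "ennreal (f t) * indicator {0<..} t = ennreal (f t * indicator {(0::real)\<^sup>2..1\<^sup>2} t)"
      by (cases "t = 0") (auto simp: f_def indicator_def)
  qed
  also have "\<dots> = (\<integral>\<^sup>+u. f (u\<^sup>2) * (2 * u) * indicator {0..1} u \<partial>lborel)"
    by (rule nn_integral_substitution) (auto simp: set_borel_measurable_def intro!: derivative_eq_intros continuous_intros)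
  also have "\<dots> = (\<integral>\<^sup>+u. ennreal 2 * ennreal (indicator {0..1} u * (u powr (2 * s + 2 - 1) * (1 - u) powr (\<rho> + 1 - 1))) \<partial>lborel)"
  proof (intro nn_integral_cong)
    fix u :: real
    have E: "f (u\<^sup>2) * (2 * u) = 2 * (u powr (2 * s + 2 - 1) * (1 - u) powr (\<rho> + 1 - 1))" if u: "0 \<le> u" "u \<le> 1"
    proof (cases "u = 0")
      case False
      then have u: "0 < u" using u by simp
      have 1: "(u\<^sup>2) powr p = u powr (2 * p)" for p
        using u powr_powr[of u 2 p] by (simp add: powr_numeral)
      have 2: "u powr (1 + 2 * s) = u powr (2 * s) * u" "u powr (2 * s + 1) = u powr (2 * s) * u"
        using u by (simp_all add: powr_add)
      show ?thesis using u that by (simp add: f_def 1 2 pos_powr_def)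
    qed (auto simp: f_def)
    show "ennreal (f (u\<^sup>2) * (2 * u) * indicator {0..1} u) =
      ennreal 2 * ennreal (indicator {0..1} u * (u powr (2 * s + 2 - 1) * (1 - u) powr (\<rho> + 1 - 1)))"
    proof (cases "u \<in> {0..1}")
      case True
      then have i: "indicator {0..1} u = (1::real)" by simp
      show ?thesis
        unfolding i mult_1_left mult_1_right E[OF True[unfolded atLeastAtMost_iff, THEN conjunct1] True[unfolded atLeastAtMost_iff, THEN conjunct2]]
        by (rule ennreal_mult) auto
    qed simp
  qed
  also have "\<dots> = ennreal 2 * (\<integral>\<^sup>+u. ennreal (indicator {0..1} u * (u powr (2 * s + 2 - 1) * (1 - u) powr (\<rho> + 1 - 1))) \<partial>lborel)"
    by (rule nn_integral_cmult) measurable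
  also have "(\<integral>\<^sup>+u. ennreal (indicator {0..1} u * (u powr (2 * s + 2 - 1) * (1 - u) powr (\<rho> + 1 - 1))) \<partial>lborel)
     = ennreal (Beta (2 * s + 2) (\<rho> + 1))"
    using s \<rho> by (intro nn_integral_has_integral_lebesgue[OF _ has_integral_Beta_real]) auto
  also have "ennreal 2 * ennreal (Beta (2 * s + 2) (\<rho> + 1)) = ennreal (2 * Beta (2 * s + 2) (\<rho> + 1))"
    by (rule ennreal_mult'[symmetric]) simp
  finally show ?thesis by (simp add: f_def)
qed

text \<open>By Tonelli the \<open>x\<close>-integral comes first; scaling the ball moment turns
  \<open>t powr \<alpha>\<close> into \<open>t powr (\<alpha> + DIM('a)/2 + k)\<close>. The lower
  bound on \<open>\<alpha>\<close> says that this exponent exceeds -1 already for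
  \<open>k = 0\<close>, even where \<open>W\<close> is infinite at the origin.\<close>

lemma W_moment:
  fixes \<xi> :: "'a::euclidean_space" and l \<alpha> \<rho> :: real
  assumes l: "-1 < l" and \<alpha>: "- (real DIM('a) + 2) / 2 < \<alpha>" and \<rho>: "-1 < \<rho>"
  shows "(\<integral>\<^sup>+x. W l \<alpha> \<rho> x * ennreal ((\<xi> \<bullet> x) ^ (2 * k)) \<partial>lborel) =
    ennreal (2 * Beta (2 * \<alpha> + DIM('a) + 2 + 2 * real k) (\<rho> + 1) * (Gamma (l + 1) / Gamma (l + DIM('a) / 2 + 1 + k) *
      (sqrt pi ^ DIM('a) * fact (2 * k) / (4 ^ k * fact k) * norm \<xi> ^ (2 * k))))"
proof -
  define R where "R = Gamma (l + 1) / Gamma (l + DIM('a) / 2 + 1 + k) *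
      (sqrt pi ^ DIM('a) * fact (2 * k) / (4 ^ k * fact k) * norm \<xi> ^ (2 * k))"
  have G: "0 < Gamma (l + 1)" "0 < Gamma (l + DIM('a) / 2 + 1 + k)"
    using l by (auto intro!: Gamma_real_pos add_pos_nonneg)
  have R: "0 \<le> R" using G by (auto simp: R_def intro!: mult_nonneg_nonneg divide_nonneg_nonneg)
  define h where "h = (\<lambda>t. ennreal (t powr \<alpha> * pos_powr (1 - t powr (1/2)) \<rho>) * indicator {0<..} t)"
  have [measurable]: "h \<in> borel_measurable borel" unfolding h_def by measurable
  have "(\<integral>\<^sup>+x. W l \<alpha> \<rho> x * ennreal ((\<xi> \<bullet> x) ^ (2 * k)) \<partial>lborel) =
    (\<integral>\<^sup>+x. \<integral>\<^sup>+t. h t * ennreal (pos_powr (1 - (norm x)\<^sup>2 / t) l * (\<xi> \<bullet> x) ^ (2 * k)) \<partial>lborel \<partial>lborel)"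
  proof (intro nn_integral_cong)
    fix x :: 'a
    have "W l \<alpha> \<rho> x * ennreal ((\<xi> \<bullet> x) ^ (2 * k)) = (\<integral>\<^sup>+t. ennreal (pos_powr (1 - (norm x)\<^sup>2 / t) l * t powr \<alpha> * pos_powr (1 - t powr (1/2)) \<rho>)
      * indicator {0<..} t * ennreal ((\<xi> \<bullet> x) ^ (2 * k)) \<partial>lborel)"
      unfolding W_def by (rule nn_integral_multc[symmetric]) measurable
    also have "\<dots> = (\<integral>\<^sup>+t. h t * ennreal (pos_powr (1 - (norm x)\<^sup>2 / t) l * (\<xi> \<bullet> x) ^ (2 * k)) \<partial>lborel)"
      by (intro nn_integral_cong) (auto simp: h_def indicator_def ennreal_mult mult_ac zero_le_power_eq)
    finally show "W l \<alpha> \<rho> x * ennreal ((\<xi> \<bullet> x) ^ (2 * k)) = \<dots>" .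
  qed
  also have "\<dots> = (\<integral>\<^sup>+t. \<integral>\<^sup>+x. h t * ennreal (pos_powr (1 - (norm x)\<^sup>2 / t) l * (\<xi> \<bullet> x) ^ (2 * k)) \<partial>lborel \<partial>lborel)"
    by (rule lborel_pair.Fubini') measurable
  also have "\<dots> = (\<integral>\<^sup>+t. (ennreal (t powr (\<alpha> + DIM('a) / 2 + real k) * pos_powr (1 - t powr (1/2)) \<rho>) * indicator {0<..} t) * ennreal R \<partial>lborel)"
  proof (intro nn_integral_cong)
    fix t :: real
    show "(\<integral>\<^sup>+x. h t * ennreal (pos_powr (1 - (norm x)\<^sup>2 / t) l * (\<xi> \<bullet> x) ^ (2 * k)) \<partial>lborel) =
      (ennreal (t powr (\<alpha> + DIM('a) / 2 + real k) * pos_powr (1 - t powr (1/2)) \<rho>) * indicator {0<..} t) * ennreal R"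
    proof (cases "0 < t")
      case True
      have "(\<integral>\<^sup>+x. h t * ennreal (pos_powr (1 - (norm x)\<^sup>2 / t) l * (\<xi> \<bullet> x) ^ (2 * k)) \<partial>lborel) =
        h t * (ennreal (t powr (DIM('a) / 2 + k)) * ennreal R)"
        by (subst nn_integral_cmult) (auto simp: nn_integral_ball_power_scale[OF True] nn_integral_ball_power_moment[OF l] R_def)
      then show ?thesis using True
        by (simp add: h_def add.assoc powr_add[of t \<alpha>] ennreal_mult mult_ac)
    qed (simp add: h_def)
  qed
  also have "\<dots> = ennreal (2 * Beta (2 * (\<alpha> + DIM('a) / 2 + real k) + 2) (\<rho> + 1)) * ennreal R"
    using \<alpha> \<rho> by (subst nn_integral_multc, measurable) (subst nn_integral_Beta_sqrt, auto simp: field_simps)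
  also have "\<dots> = ennreal (2 * Beta (2 * (\<alpha> + DIM('a) / 2 + real k) + 2) (\<rho> + 1) * R)"
    using R by (rule ennreal_mult''[symmetric])
  also have "2 * (\<alpha> + DIM('a) / 2 + real k) + 2 = 2 * \<alpha> + DIM('a) + 2 + 2 * real k" by (simp add: algebra_simps)
  finally show ?thesis by (simp add: R_def)
qed

lemma W_uminus: "W l \<alpha> \<rho> (- x) = W l \<alpha> \<rho> x"
  by (simp add: W_def)

text \<open>As \<open>0 ^ 0 = 1\<close>, the moment with \<open>\<xi> = 0\<close> and
  \<open>k = 0\<close> is the integral of \<open>W\<close> itself, and \<open>W_moment\<close> gives
  it a finite value.\<close>

lemma AE_W_finite:
  assumes l: "-1 < l" and \<alpha>: "- (real DIM('a) + 2) / 2 < \<alpha>" and \<rho>: "-1 < \<rho>"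
  shows "AE x::'a::euclidean_space in lborel. W l \<alpha> \<rho> x \<noteq> \<infinity>"
proof (rule nn_integral_PInf_AE)
  show "integral\<^sup>N lborel (W l \<alpha> \<rho> :: 'a \<Rightarrow> ennreal) \<noteq> \<infinity>"
    using W_moment[OF assms, of "0::'a" 0] by simp
qed simp

lemma cos_transform_W:
  fixes \<xi> :: "'a::euclidean_space" and l \<alpha> \<rho> :: real
  defines "n \<equiv> real DIM('a)"
  assumes l: "-1 < l" and \<alpha>: "- (n + 2) / 2 < \<alpha>" and \<rho>: "1 \<le> \<rho>"
    and "\<alpha> \<le> l" "4 * \<alpha> \<le> 3 * l - (n + 3) / 2 + \<rho>" "2 * \<alpha> \<le> l - (n + 1) / 2 + \<rho>"
  shows "integrable lborel (\<lambda>x::'a. enn2real (W l \<alpha> \<rho> x))"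
    and "0 < (\<integral>x. enn2real (W l \<alpha> \<rho> x) * cos (\<xi> \<bullet> x) \<partial>lborel)"
proof -
  define m where "m = 2 * \<alpha> + n + 1"
  define \<nu> where "\<nu> = l + n / 2"
  have n: "1 \<le> n" unfolding n_def using DIM_positive[where 'a = 'a] by linarith
  have pos: "-1 < m" "-1/2 < \<nu>" using \<alpha> l n by (auto simp: m_def \<nu>_def field_simps)
  have ps: "pos_series (bessel_integral_coeff m \<nu> \<rho>)"
    using assms n pos by (intro pos_series_bessel_integral) (auto simp: m_def \<nu>_def field_simps)
  define e where "e = (\<lambda>k. 2 * Beta (m + 1 + 2 * real k) (\<rho> + 1) * (Gamma (l + 1) / Gamma (\<nu> + 1 + k) *
      (sqrt pi ^ DIM('a) * (1 / (4 ^ k * fact k)) * norm \<xi> ^ (2 * k))))"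
  \<comment> \<open>\<open>K\<close> collects all factors independent of \<open>k\<close>. The two
    quotients of Gamma values are the constants of the duplication formula for
    \<open>Gamma (m + 1 + 2 * k)\<close> and \<open>Gamma (m + \<rho> + 2 + 2 * k)\<close>, which
    occur in the Beta function; their powers of 4 cancel.\<close>
  define K where "K = 2 * Gamma (\<rho> + 1) * Gamma (l + 1) * sqrt pi ^ DIM('a) *
    (Gamma (m + 1) / (Gamma ((m + 1) / 2) * Gamma ((m + 1 + 1) / 2))) /
    (Gamma (m + \<rho> + 2) / (Gamma ((m + \<rho> + 2) / 2) * Gamma ((m + \<rho> + 2 + 1) / 2)))"
  have K: "0 < K"
    unfolding K_def using pos l \<rho>
    by (intro divide_pos_pos mult_pos_pos Gamma_real_pos zero_less_power) auto
  have eK: "(-1) ^ k * e k = K * (bessel_integral_coeff m \<nu> \<rho> k * ((norm \<xi>)\<^sup>2) ^ k)" for k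
  proof -
    define A where "A = Gamma (m + 1) / (Gamma ((m + 1) / 2) * Gamma ((m + 1 + 1) / 2))"
    define B where "B = Gamma (m + \<rho> + 2) / (Gamma ((m + \<rho> + 2) / 2) * Gamma ((m + \<rho> + 2 + 1) / 2))"
    define p where "p = Gamma ((m + 1) / 2 + k)"
    define q where "q = Gamma ((m + 2) / 2 + k)"
    define r where "r = Gamma ((m + \<rho> + 2) / 2 + k)"
    define t where "t = Gamma ((m + \<rho> + 3) / 2 + k)"
    define u where "u = Gamma (\<nu> + 1 + k)"
    have 1: "Gamma (m + 1 + 2 * real k) = A * 4 ^ k * p * q"
      using Gamma_double_shift[of "m + 1" k] pos by (simp add: A_def p_def q_def add.assoc)
    have 2: "Gamma (m + \<rho> + 2 + 2 * real k) = B * 4 ^ k * r * t"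
      using Gamma_double_shift[of "m + \<rho> + 2" k] pos \<rho> by (simp add: B_def r_def t_def add.assoc)
    have "Beta (m + 1 + 2 * real k) (\<rho> + 1) = Gamma (m + 1 + 2 * real k) * Gamma (\<rho> + 1) / Gamma (m + \<rho> + 2 + 2 * real k)"
      by (simp add: Beta_def add_ac)
    also have "\<dots> = A * p * q * Gamma (\<rho> + 1) / (B * r * t)"
      unfolding 1 2 by simp
    finally have "e k = 2 * (A * p * q * Gamma (\<rho> + 1) / (B * r * t)) * (Gamma (l + 1) / u *
      (sqrt pi ^ DIM('a) * (1 / (4 ^ k * fact k)) * ((norm \<xi>)\<^sup>2) ^ k))"
      unfolding e_def u_def power_mult[of "norm \<xi>" 2 k] by simp
    moreover have "bessel_integral_coeff m \<nu> \<rho> k = (-1) ^ k / 4 ^ k * (p * q) / (r * t * u * fact k)"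
      by (simp add: bessel_integral_coeff_def p_def q_def r_def t_def u_def power_divide[symmetric])
    moreover have "K = 2 * Gamma (\<rho> + 1) * Gamma (l + 1) * sqrt pi ^ DIM('a) * A / B"
      by (simp add: K_def A_def B_def)
    ultimately show ?thesis by (simp add: mult_ac)
  qed
  have e0: "0 \<le> e k" for k
    unfolding e_def Beta_def using pos l \<rho>
    by (intro mult_nonneg_nonneg divide_nonneg_nonneg less_imp_le[OF Gamma_real_pos]) auto
  have summ: "summable (\<lambda>k. bessel_integral_coeff m \<nu> \<rho> k * ((norm \<xi>)\<^sup>2) ^ k)"
    using ps by (auto simp: pos_series_def entire_coeffs_def)
  have "summable (\<lambda>k. \<bar>bessel_integral_coeff m \<nu> \<rho> k * ((norm \<xi>)\<^sup>2) ^ k\<bar>)"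
    using ps by (intro entire_coeffs_abs) (auto simp: pos_series_def)
  then have "summable (\<lambda>k. K * \<bar>bessel_integral_coeff m \<nu> \<rho> k * ((norm \<xi>)\<^sup>2) ^ k\<bar>)"
    by (rule summable_mult)
  moreover have "K * \<bar>bessel_integral_coeff m \<nu> \<rho> k * ((norm \<xi>)\<^sup>2) ^ k\<bar> = e k" for k
    using arg_cong[OF eK[of k], of abs] e0[of k] K by (simp add: abs_mult)
  ultimately have es: "summable e" by simp
  have \<rho>': "-1 < \<rho>" using \<rho> by simp
  \<comment> \<open>Passing through \<open>enn2real\<close> replaces a possible value
    \<open>\<infinity>\<close> by 0, which happens only on a null set and leaves the moments
    unchanged.\<close>
  have mom: "(\<integral>\<^sup>+x. ennreal (enn2real (W l \<alpha> \<rho> x) * (\<xi> \<bullet> x) ^ (2 * k)) \<partial>lborel) = ennreal (fact (2 * k) * e k)" for k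
  proof -
    have "(\<integral>\<^sup>+x. ennreal (enn2real (W l \<alpha> \<rho> x) * (\<xi> \<bullet> x) ^ (2 * k)) \<partial>lborel) =
      (\<integral>\<^sup>+x. W l \<alpha> \<rho> x * ennreal ((\<xi> \<bullet> x) ^ (2 * k)) \<partial>lborel)"
    proof (rule nn_integral_cong_AE)
      show "AE x in lborel. ennreal (enn2real (W l \<alpha> \<rho> x) * (\<xi> \<bullet> x) ^ (2 * k)) = W l \<alpha> \<rho> x * ennreal ((\<xi> \<bullet> x) ^ (2 * k))"
        using AE_W_finite[OF l \<alpha>[unfolded n_def] \<rho>']
        by eventually_elim (simp add: ennreal_mult less_top)
    qed
    also have "\<dots> = ennreal (2 * Beta (2 * \<alpha> + DIM('a) + 2 + 2 * real k) (\<rho> + 1) * (Gamma (l + 1) / Gamma (l + DIM('a) / 2 + 1 + k) *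
      (sqrt pi ^ DIM('a) * fact (2 * k) / (4 ^ k * fact k) * norm \<xi> ^ (2 * k))))"
      by (rule W_moment[OF l \<alpha>[unfolded n_def] \<rho>'])
    also have "2 * \<alpha> + DIM('a) + 2 + 2 * real k = m + 1 + 2 * real k" by (simp add: m_def n_def)
    also have "l + DIM('a) / 2 + 1 + k = \<nu> + 1 + k" by (simp add: \<nu>_def n_def)
    finally show ?thesis by (simp add: e_def mult_ac)
  qed
  have me: "(\<lambda>x::'a. enn2real (W l \<alpha> \<rho> x)) \<in> borel_measurable borel" by measurable
  from cos_transform_moments(1)[OF me enn2real_nonneg mom e0 es]
  show "integrable lborel (\<lambda>x::'a. enn2real (W l \<alpha> \<rho> x))" .
  have "(\<integral>x. enn2real (W l \<alpha> \<rho> x) * cos (\<xi> \<bullet> x) \<partial>lborel) = K * (\<Sum>k. bessel_integral_coeff m \<nu> \<rho> k * ((norm \<xi>)\<^sup>2) ^ k)"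
    unfolding cos_transform_moments(2)[OF me enn2real_nonneg mom e0 es] eK
    by (rule suminf_mult[OF summ])
  also have "0 < \<dots>" using K ps by (simp add: pos_series_def)
  finally show "0 < (\<integral>x. enn2real (W l \<alpha> \<rho> x) * cos (\<xi> \<bullet> x) \<partial>lborel)" .
qed

section \<open>Positive definiteness\<close>

lemma integral_lborel_scale:
  fixes f :: "'a::euclidean_space \<Rightarrow> real"
  assumes [measurable]: "f \<in> borel_measurable borel" and c: "0 < c"
  shows "(\<integral>x. f x \<partial>lborel) = c ^ DIM('a) * (\<integral>x. f (t + c *\<^sub>R x) \<partial>lborel)"
proof -
  have "integral\<^sup>L lborel f = integral\<^sup>L (density (distr lborel borel (\<lambda>x. t + c *\<^sub>R x)) (\<lambda>_. ennreal (c ^ DIM('a)))) f"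
    using lborel_affine[of c t] c by (simp add: ennreal_power)
  also have "\<dots> = c ^ DIM('a) * (\<integral>x. f (t + c *\<^sub>R x) \<partial>lborel)"
    using c by (subst integral_density) (auto simp: integral_distr)
  finally show ?thesis .
qed

lemma integrable_lborel_scale:
  fixes f :: "'a::euclidean_space \<Rightarrow> real"
  assumes f: "integrable lborel f" and c: "0 < c"
  shows "integrable lborel (\<lambda>x. f (t + c *\<^sub>R x))"
proof -
  have [measurable]: "f \<in> borel_measurable borel" using f by auto
  have "integrable (density (distr lborel borel (\<lambda>x. t + c *\<^sub>R x)) (\<lambda>_. ennreal (c ^ DIM('a)))) f"
    using lborel_affine[of c t] c f by (simp add: ennreal_power)
  then have "integrable lborel (\<lambda>x. c ^ DIM('a) * f (t + c *\<^sub>R x))"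
    using c by (subst (asm) integrable_density) (auto simp: integrable_distr_eq)
  then show ?thesis using c by simp
qed

lemma integrable_gaussian:
  assumes "0 < d"
  shows "integrable lborel (\<lambda>x::'a::euclidean_space. exp (- d\<^sup>2 * (norm x)\<^sup>2))"
  using integrable_lborel_scale[OF integral_gaussian_cos(2) assms, of "0::'a"] assms by (simp add: power_mult_distrib)

lemma integral_gaussian_cos_scale:
  fixes z :: "'a::euclidean_space"
  assumes d: "0 < d"
  shows "(\<integral>x. exp (- d\<^sup>2 * (norm x)\<^sup>2) * cos (x \<bullet> z) \<partial>lborel) = (sqrt pi / d) ^ DIM('a) * exp (- (norm z)\<^sup>2 / (4 * d\<^sup>2))"
proof -
  have "sqrt pi ^ DIM('a) * exp (- (norm (z /\<^sub>R d))\<^sup>2 / 4) = (\<integral>x. exp (- (norm x)\<^sup>2) * cos ((z /\<^sub>R d) \<bullet> x) \<partial>lborel)"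
    by (rule integral_gaussian_cos(1)[symmetric])
  also have "\<dots> = d ^ DIM('a) * (\<integral>x. exp (- (norm (0 + d *\<^sub>R x))\<^sup>2) * cos ((z /\<^sub>R d) \<bullet> (0 + d *\<^sub>R x)) \<partial>lborel)"
    by (rule integral_lborel_scale[OF _ d]) measurable
  also have "\<dots> = d ^ DIM('a) * (\<integral>x. exp (- d\<^sup>2 * (norm x)\<^sup>2) * cos (x \<bullet> z) \<partial>lborel)"
  proof (intro arg_cong[where f = "\<lambda>x. _ * x"] Bochner_Integration.integral_cong refl)
    fix x :: 'a
    have "(z /\<^sub>R d) \<bullet> (0 + d *\<^sub>R x) = inverse d * d * (x \<bullet> z)" by (simp add: inner_commute)
    also have "inverse d * d = 1" using d by simp
    finally show "exp (- (norm (0 + d *\<^sub>R x))\<^sup>2) * cos ((z /\<^sub>R d) \<bullet> (0 + d *\<^sub>R x)) = exp (- d\<^sup>2 * (norm x)\<^sup>2) * cos (x \<bullet> z)"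
      by (simp add: power_mult_distrib)
  qed
  also have "- (norm (z /\<^sub>R d))\<^sup>2 / 4 = - (norm z)\<^sup>2 / (4 * d\<^sup>2)"
  proof -
    have "norm (z /\<^sub>R d) = norm z / d" using d by (simp add: divide_inverse_commute)
    then show ?thesis by (simp add: power_divide)
  qed
  finally have "(\<integral>x. exp (- d\<^sup>2 * (norm x)\<^sup>2) * cos (x \<bullet> z) \<partial>lborel) * d ^ DIM('a) =
      sqrt pi ^ DIM('a) * exp (- (norm z)\<^sup>2 / (4 * d\<^sup>2))"
    by (simp only: mult.commute)
  then show ?thesis using d by (simp add: power_divide eq_divide_eq)
qed

text \<open>Fourier inversion with a Gaussian weight. Fubini, justified by the majorant
  \<open>w x * E \<xi>\<close>, lets the \<open>\<xi>\<close>-integral produce a Gaussian in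
  \<open>x\<close> centred at \<open>z\<close>; then \<open>x = z + 2 * d * u\<close>. The powers of
  \<open>d\<close> cancel, so the constant does not depend on \<open>d\<close>.\<close>

lemma cos_transform_gaussian_average:
  fixes w :: "'a::euclidean_space \<Rightarrow> real"
  assumes w: "integrable lborel w" and even: "\<And>x. w (- x) = w x" and d: "0 < d"
  shows "(\<integral>\<xi>. (\<integral>x. w x * cos (\<xi> \<bullet> x) \<partial>lborel) * cos (\<xi> \<bullet> z) * exp (- d\<^sup>2 * (norm \<xi>)\<^sup>2) \<partial>lborel) =
    (2 * sqrt pi) ^ DIM('a) * (\<integral>u. w (z + (2 * d) *\<^sub>R u) * exp (- (norm u)\<^sup>2) \<partial>lborel)"
proof -
  have [measurable]: "w \<in> borel_measurable borel" using w by auto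
  define E where "E = (\<lambda>\<xi>::'a. exp (- d\<^sup>2 * (norm \<xi>)\<^sup>2))"
  have [measurable]: "E \<in> borel_measurable borel" unfolding E_def by measurable
  have Ei: "integrable lborel E" unfolding E_def by (rule integrable_gaussian[OF d])
  have E0: "0 \<le> E \<xi>" for \<xi> by (simp add: E_def)
  define f where "f = (\<lambda>x \<xi>. w x * (cos (\<xi> \<bullet> (x - z)) * E \<xi>))"
  have hi: "integrable (lborel \<Otimes>\<^sub>M lborel) (\<lambda>(x, \<xi>). w x * E \<xi>)"
  proof (rule lborel_pair.Fubini_integrable)
    have "(\<lambda>x. \<integral>\<xi>. norm (w x * E \<xi>) \<partial>lborel) = (\<lambda>x. \<bar>w x\<bar> * (\<integral>\<xi>. E \<xi> \<partial>lborel))"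
      using E0 by (simp add: abs_mult)
    then show "integrable lborel (\<lambda>x. \<integral>\<xi>. norm (case (x, \<xi>) of (x, \<xi>) \<Rightarrow> w x * E \<xi>) \<partial>lborel)"
      using w by simp
  qed (use Ei in auto)
  have fi: "integrable (lborel \<Otimes>\<^sub>M lborel) (\<lambda>(x, \<xi>). f x \<xi>)"
  proof (rule Bochner_Integration.integrable_bound[OF hi])
    show "(\<lambda>(x, \<xi>). f x \<xi>) \<in> borel_measurable (lborel \<Otimes>\<^sub>M lborel)" unfolding f_def by measurable
    show "AE p in lborel \<Otimes>\<^sub>M lborel. norm (case p of (x, \<xi>) \<Rightarrow> f x \<xi>) \<le> norm (case p of (x, \<xi>) \<Rightarrow> w x * E \<xi>)"
      using E0 by (intro AE_I2) (auto simp: f_def abs_mult intro!: mult_left_mono mult_left_le_one_le)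
  qed
  have "(\<integral>\<xi>. (\<integral>x. w x * cos (\<xi> \<bullet> x) \<partial>lborel) * cos (\<xi> \<bullet> z) * E \<xi> \<partial>lborel) = (\<integral>\<xi>. (\<integral>x. f x \<xi> \<partial>lborel) \<partial>lborel)"
  proof (intro Bochner_Integration.integral_cong refl)
    fix \<xi>
    have i: "integrable lborel (\<lambda>x. w x * cos (\<xi> \<bullet> x))" "integrable lborel (\<lambda>x. w x * sin (\<xi> \<bullet> x))"
      by (intro integrable_mult_bounded w; auto)+
    \<comment> \<open>The sine integral is 0 by evenness; adding it completes the product of cosines
      to \<open>cos (\<xi> \<bullet> (x - z))\<close>.\<close>
    have "(\<integral>x. w x * cos (\<xi> \<bullet> x) \<partial>lborel) * cos (\<xi> \<bullet> z) * E \<xi> =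
      (\<integral>x. w x * cos (\<xi> \<bullet> x) \<partial>lborel) * (cos (\<xi> \<bullet> z) * E \<xi>) + (\<integral>x. w x * sin (\<xi> \<bullet> x) \<partial>lborel) * (sin (\<xi> \<bullet> z) * E \<xi>)"
      using integral_even_sin[of w \<xi>] even by simp
    also have "\<dots> = (\<integral>x. w x * cos (\<xi> \<bullet> x) * (cos (\<xi> \<bullet> z) * E \<xi>) + w x * sin (\<xi> \<bullet> x) * (sin (\<xi> \<bullet> z) * E \<xi>) \<partial>lborel)"
      using i by (subst Bochner_Integration.integral_add) auto
    also have "\<dots> = (\<integral>x. f x \<xi> \<partial>lborel)"
      by (intro Bochner_Integration.integral_cong refl) (simp add: f_def inner_diff_right cos_diff algebra_simps)
    finally show "(\<integral>x. w x * cos (\<xi> \<bullet> x) \<partial>lborel) * cos (\<xi> \<bullet> z) * E \<xi> = (\<integral>x. f x \<xi> \<partial>lborel)" .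
  qed
  also have "\<dots> = (\<integral>x. (\<integral>\<xi>. f x \<xi> \<partial>lborel) \<partial>lborel)"
    by (rule lborel_pair.Fubini_integral[OF fi])
  also have "\<dots> = (\<integral>x. w x * ((sqrt pi / d) ^ DIM('a) * exp (- (norm (x - z))\<^sup>2 / (4 * d\<^sup>2))) \<partial>lborel)"
    using integral_gaussian_cos_scale[OF d, where 'a = 'a] by (simp add: f_def E_def mult.commute)
  also have "\<dots> = (2 * d) ^ DIM('a) * (\<integral>u. w (z + (2 * d) *\<^sub>R u) * ((sqrt pi / d) ^ DIM('a) * exp (- (norm ((z + (2 * d) *\<^sub>R u) - z))\<^sup>2 / (4 * d\<^sup>2))) \<partial>lborel)"
    by (rule integral_lborel_scale) (use d in auto)
  also have "\<dots> = (2 * d) ^ DIM('a) * (\<integral>u. (sqrt pi / d) ^ DIM('a) * (w (z + (2 * d) *\<^sub>R u) * exp (- (norm u)\<^sup>2)) \<partial>lborel)"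
    using d by (intro arg_cong[where f = "\<lambda>x. _ * x"] Bochner_Integration.integral_cong refl) (simp add: power_mult_distrib)
  also have "\<dots> = ((2 * d) * (sqrt pi / d)) ^ DIM('a) * (\<integral>u. w (z + (2 * d) *\<^sub>R u) * exp (- (norm u)\<^sup>2) \<partial>lborel)"
    by (simp only: power_mult_distrib mult.assoc integral_mult_right_zero)
  also have "(2 * d) * (sqrt pi / d) = 2 * sqrt pi" using d by simp
  finally show ?thesis by (simp only: E_def)
qed

text \<open>Both sides are the squared modulus of the exponential sum with coefficients
  \<open>c i\<close> and phases \<open>t i\<close>.\<close>

lemma sum_cos_diff:
  fixes c t :: "'i \<Rightarrow> real"
  shows "(\<Sum>i\<in>I. \<Sum>j\<in>I. c i * c j * cos (t i - t j)) = (\<Sum>i\<in>I. c i * cos (t i))\<^sup>2 + (\<Sum>i\<in>I. c i * sin (t i))\<^sup>2"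
  by (simp add: power2_eq_square sum_product cos_diff algebra_simps sum.distrib)

text \<open>The transform \<open>g\<close> is known to be bounded but not to be integrable, so
  inversion uses the weights \<open>E d\<close> and lets \<open>d\<close> tend to 0. The weighted
  integrals of \<open>g * P\<close> converge to a positive multiple of the quadratic form.
  Strictness survives because \<open>E 1 \<le> E d\<close> for \<open>d \<le> 1\<close> keeps them
  all above the fixed number \<open>q > 0\<close>.\<close>

lemma cos_transform_pos_imp_positive_definite:
  fixes w :: "'a::euclidean_space \<Rightarrow> real" and x :: "nat \<Rightarrow> 'a"
  assumes w: "integrable lborel w" and even: "\<And>x. w (- x) = w x"
    and cont: "continuous_on UNIV w" and bdd: "\<And>x. \<bar>w x\<bar> \<le> B"
    and pos: "\<And>\<xi>. 0 < (\<integral>x. w x * cos (\<xi> \<bullet> x) \<partial>lborel)"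
    and x: "inj_on x {..<N}" and c: "\<exists>i<N. c i \<noteq> 0"
  shows "0 < (\<Sum>i<N. \<Sum>j<N. c i * c j * w (x i - x j))"
proof -
  have [measurable]: "w \<in> borel_measurable borel" using w by auto
  define g where "g = (\<lambda>\<xi>. \<integral>x. w x * cos (\<xi> \<bullet> x) \<partial>lborel)"
  have [measurable]: "g \<in> borel_measurable borel" unfolding g_def by measurable
  define P where "P = (\<lambda>\<xi>. \<Sum>i<N. \<Sum>j<N. c i * c j * cos (\<xi> \<bullet> (x i - x j)))"
  have [measurable]: "P \<in> borel_measurable borel" unfolding P_def by measurable
  have P0: "0 \<le> P \<xi>" for \<xi>
    unfolding P_def inner_diff_right sum_cos_diff by simp
  define Z where "Z = (\<integral>x. \<bar>w x\<bar> \<partial>lborel)"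
  have gZ: "\<bar>g \<xi>\<bar> \<le> Z" for \<xi>
  proof -
    have "\<bar>g \<xi>\<bar> \<le> (\<integral>x. \<bar>w x * cos (\<xi> \<bullet> x)\<bar> \<partial>lborel)"
      unfolding g_def by (rule integral_abs_bound)
    also have "\<dots> \<le> Z"
      unfolding Z_def
      by (intro integral_mono integrable_abs integrable_mult_bounded w) (auto simp: abs_mult mult_left_le)
    finally show ?thesis .
  qed
  define E where "E = (\<lambda>d (\<xi>::'a). exp (- d\<^sup>2 * (norm \<xi>)\<^sup>2))"
  have Em [measurable]: "E d \<in> borel_measurable borel" for d unfolding E_def by measurable
  have Ei: "integrable lborel (E d)" if "0 < d" for d unfolding E_def by (rule integrable_gaussian[OF that])
  have E0: "0 < E d \<xi>" for d \<xi> by (simp add: E_def)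
  have cEi: "integrable lborel (\<lambda>\<xi>. cos (\<xi> \<bullet> z) * E d \<xi>)" if "0 < d" for d z
    using integrable_mult_bounded[OF Ei[OF that], of "\<lambda>\<xi>. cos (\<xi> \<bullet> z)"] by (simp add: mult.commute)
  have gEi: "integrable lborel (\<lambda>\<xi>. g \<xi> * cos (\<xi> \<bullet> z) * E d \<xi>)" if "0 < d" for d z
  proof (rule Bochner_Integration.integrable_bound[OF integrable_mult_right[OF Ei[OF that], of Z]])
    show "AE \<xi> in lborel. norm (g \<xi> * cos (\<xi> \<bullet> z) * E d \<xi>) \<le> norm (Z * E d \<xi>)"
    proof (rule AE_I2)
      fix \<xi>
      have "\<bar>g \<xi>\<bar> * \<bar>cos (\<xi> \<bullet> z)\<bar> \<le> Z * 1" using gZ[of \<xi>] by (intro mult_mono) auto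
      also have "\<dots> \<le> \<bar>Z\<bar>" by simp
      finally show "norm (g \<xi> * cos (\<xi> \<bullet> z) * E d \<xi>) \<le> norm (Z * E d \<xi>)"
        using E0[of d \<xi>] by (simp add: abs_mult mult_right_mono)
    qed
  qed measurable
  have gP: "(\<integral>\<xi>. g \<xi> * P \<xi> * E d \<xi> \<partial>lborel) = (\<Sum>i<N. \<Sum>j<N. c i * c j * (\<integral>\<xi>. g \<xi> * cos (\<xi> \<bullet> (x i - x j)) * E d \<xi> \<partial>lborel))"
    "integrable lborel (\<lambda>\<xi>. g \<xi> * P \<xi> * E d \<xi>)" if d: "0 < d" for d
  proof -
    have eq: "g \<xi> * P \<xi> * E d \<xi> = (\<Sum>i<N. \<Sum>j<N. c i * c j * (g \<xi> * cos (\<xi> \<bullet> (x i - x j)) * E d \<xi>))" for \<xi>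
      by (simp add: P_def sum_distrib_left sum_distrib_right mult_ac)
    show "(\<integral>\<xi>. g \<xi> * P \<xi> * E d \<xi> \<partial>lborel) = (\<Sum>i<N. \<Sum>j<N. c i * c j * (\<integral>\<xi>. g \<xi> * cos (\<xi> \<bullet> (x i - x j)) * E d \<xi> \<partial>lborel))"
      unfolding eq using gEi[OF d] by (simp add: Bochner_Integration.integral_sum)
    show "integrable lborel (\<lambda>\<xi>. g \<xi> * P \<xi> * E d \<xi>)"
      unfolding eq using gEi[OF d] by simp
  qed
  define q where "q = (\<integral>\<xi>. g \<xi> * P \<xi> * E 1 \<xi> \<partial>lborel)"
  have gpos: "0 < g \<xi>" for \<xi> unfolding g_def by (rule pos)
  have gPE: "0 \<le> g \<xi> * P \<xi> * E d \<xi>" for d \<xi>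
    by (intro mult_nonneg_nonneg P0 less_imp_le[OF gpos] less_imp_le[OF E0])
  have q0: "0 < q"
  proof (rule ccontr)
    assume "\<not> 0 < q"
    moreover have "0 \<le> q" unfolding q_def by (intro integral_nonneg_AE AE_I2 gPE)
    ultimately have "q = 0" by simp
    then have "AE \<xi> in lborel. g \<xi> * P \<xi> * E 1 \<xi> = 0"
      unfolding q_def using gP(2)[of 1] gPE
      by (subst (asm) integral_nonneg_eq_0_iff_AE) auto
    then have AE0: "AE \<xi> in lborel. P \<xi> = 0"
      by eventually_elim (use gpos E0 in \<open>auto simp: less_imp_neq[symmetric]\<close>)
    \<comment> \<open>Integrating \<open>P = 0\<close> against ever wider Gaussians isolates the diagonal \<open>\<Sum>i. (c i)\<^sup>2\<close>.\<close>
    have z: "(\<Sum>i<N. \<Sum>j<N. c i * c j * exp (- (norm (x i - x j))\<^sup>2 / (4 * d\<^sup>2))) = 0" if d: "0 < d" for d :: real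
    proof -
      have "0 = (\<integral>\<xi>. P \<xi> * E d \<xi> \<partial>lborel)"
        using AE0 by (intro integral_eq_zero_AE[symmetric]) auto
      also have "\<dots> = (\<integral>\<xi>. (\<Sum>i<N. \<Sum>j<N. c i * c j * (cos (\<xi> \<bullet> (x i - x j)) * E d \<xi>)) \<partial>lborel)"
        by (simp add: P_def sum_distrib_left sum_distrib_right mult_ac)
      also have "\<dots> = (\<Sum>i<N. \<Sum>j<N. c i * c j * (\<integral>\<xi>. cos (\<xi> \<bullet> (x i - x j)) * E d \<xi> \<partial>lborel))"
        using cEi[OF d] by (simp add: Bochner_Integration.integral_sum)
      also have "\<dots> = (\<Sum>i<N. \<Sum>j<N. c i * c j * ((sqrt pi / d) ^ DIM('a) * exp (- (norm (x i - x j))\<^sup>2 / (4 * d\<^sup>2))))"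
        using integral_gaussian_cos_scale[OF d, where 'a = 'a] by (simp add: E_def mult.commute[of "cos _"])
      also have "\<dots> = (sqrt pi / d) ^ DIM('a) * (\<Sum>i<N. \<Sum>j<N. c i * c j * exp (- (norm (x i - x j))\<^sup>2 / (4 * d\<^sup>2)))"
        by (simp add: sum_distrib_left mult_ac)
      finally show ?thesis using d by simp
    qed
    have lim: "(\<lambda>k. exp (- (norm (x i - x j))\<^sup>2 / (4 * (1 / real (Suc k))\<^sup>2))) \<longlonglongrightarrow> (if i = j then 1 else 0)"
      if "i < N" "j < N" for i j
    proof (cases "i = j")
      case False
      then have "0 < norm (x i - x j)" using x that by (auto simp: inj_on_def)
      then have "(\<lambda>k. exp (- (norm (x i - x j))\<^sup>2 / (4 * (1 / real (Suc k))\<^sup>2))) \<longlonglongrightarrow> 0"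
        by real_asymp
      then show ?thesis using False by simp
    qed simp
    have "(\<lambda>k. \<Sum>i<N. \<Sum>j<N. c i * c j * exp (- (norm (x i - x j))\<^sup>2 / (4 * (1 / real (Suc k))\<^sup>2)))
       \<longlonglongrightarrow> (\<Sum>i<N. \<Sum>j<N. c i * c j * (if i = j then 1 else 0))"
      by (intro tendsto_sum tendsto_mult tendsto_const lim) auto
    then have "(\<lambda>k. 0) \<longlonglongrightarrow> (\<Sum>i<N. \<Sum>j<N. c i * c j * (if i = j then 1 else 0))"
      by (subst (asm) z) auto
    then have "(\<Sum>i<N. \<Sum>j<N. c i * c j * (if i = j then 1 else 0)) = 0"
      by (simp add: LIMSEQ_const_iff)
    also have "(\<Sum>i<N. \<Sum>j<N. c i * c j * (if i = j then 1 else 0)) = (\<Sum>i<N. c i * c i)"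
      by (intro sum.cong refl) (simp add: if_distrib[of "\<lambda>x. _ * x"] cong: if_cong)
    finally have "(\<Sum>i<N. c i * c i) = 0" .
    then show False using c by (auto simp: sum_nonneg_eq_0_iff)
  qed
  define A where "A = (\<lambda>d z. \<integral>u. w (z + (2 * d) *\<^sub>R u) * exp (- (norm u)\<^sup>2) \<partial>lborel)"
  have qA: "q \<le> (\<Sum>i<N. \<Sum>j<N. c i * c j * ((2 * sqrt pi) ^ DIM('a) * A d (x i - x j)))" if d: "0 < d" "d \<le> 1" for d
  proof -
    have "q \<le> (\<integral>\<xi>. g \<xi> * P \<xi> * E d \<xi> \<partial>lborel)"
      unfolding q_def
    proof (intro integral_mono gP d)
      fix \<xi>
      have "d\<^sup>2 \<le> 1" using d by (simp add: power_le_one)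
      then have "E 1 \<xi> \<le> E d \<xi>" by (simp add: E_def mult_right_mono mult_left_le_one_le)
      then show "g \<xi> * P \<xi> * E 1 \<xi> \<le> g \<xi> * P \<xi> * E d \<xi>"
        using gpos[of \<xi>] P0[of \<xi>] by (intro mult_left_mono) auto
    qed simp
    also have "\<dots> = (\<Sum>i<N. \<Sum>j<N. c i * c j * ((2 * sqrt pi) ^ DIM('a) * A d (x i - x j)))"
      unfolding gP(1)[OF d(1)] using cos_transform_gaussian_average[OF w even d(1)]
      by (simp add: g_def E_def A_def)
    finally show ?thesis .
  qed
  \<comment> \<open>Continuity of \<open>w\<close> gives the pointwise limit \<open>w z\<close>, and
    the bound \<open>B\<close> gives an integrable Gaussian majorant.\<close>
  have "(\<lambda>k. A (1 / real (Suc k)) z) \<longlonglongrightarrow> (\<integral>u. w z * exp (- (norm (u::'a))\<^sup>2) \<partial>lborel)" for z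
    unfolding A_def
  proof (rule integral_dominated_convergence)
    show "integrable lborel (\<lambda>u::'a. B * exp (- (norm u)\<^sup>2))"
      by (intro integrable_mult_right integral_gaussian_cos(2))
    show "AE u in lborel. (\<lambda>k. w (z + (2 * (1 / real (Suc k))) *\<^sub>R u) * exp (- (norm u)\<^sup>2)) \<longlonglongrightarrow> w z * exp (- (norm u)\<^sup>2)"
    proof (rule AE_I2, intro tendsto_mult tendsto_const)
      fix u
      have "(\<lambda>k. 2 * (1 / real (Suc k))) \<longlonglongrightarrow> 0" by real_asymp
      then have "(\<lambda>k. z + (2 * (1 / real (Suc k))) *\<^sub>R u) \<longlonglongrightarrow> z + 0 *\<^sub>R u"
        by (intro tendsto_intros)
      then have "(\<lambda>k. z + (2 * (1 / real (Suc k))) *\<^sub>R u) \<longlonglongrightarrow> z" by simp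
      then show "(\<lambda>k. w (z + (2 * (1 / real (Suc k))) *\<^sub>R u)) \<longlonglongrightarrow> w z"
        using cont by (intro continuous_on_tendsto_compose[OF cont]) auto
    qed
    show "AE u in lborel. norm (w (z + (2 * (1 / real (Suc k))) *\<^sub>R u) * exp (- (norm u)\<^sup>2)) \<le> B * exp (- (norm u)\<^sup>2)" for k
      using bdd by (intro AE_I2) (simp add: abs_mult)
  qed measurable
  then have limA: "(\<lambda>k. A (1 / real (Suc k)) z) \<longlonglongrightarrow> w z * sqrt pi ^ DIM('a)" for z
    using integral_gaussian_cos(1)[of "0::'a"] by simp
  have "(\<lambda>k. \<Sum>i<N. \<Sum>j<N. c i * c j * ((2 * sqrt pi) ^ DIM('a) * A (1 / real (Suc k)) (x i - x j)))
    \<longlonglongrightarrow> (\<Sum>i<N. \<Sum>j<N. c i * c j * ((2 * sqrt pi) ^ DIM('a) * (w (x i - x j) * sqrt pi ^ DIM('a))))"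
    by (intro tendsto_sum tendsto_mult tendsto_const limA)
  then have "q \<le> (\<Sum>i<N. \<Sum>j<N. c i * c j * ((2 * sqrt pi) ^ DIM('a) * (w (x i - x j) * sqrt pi ^ DIM('a))))"
    by (rule LIMSEQ_le_const) (intro exI[of _ 0] allI impI qA; simp)
  also have "\<dots> = ((2 * sqrt pi) ^ DIM('a) * sqrt pi ^ DIM('a)) * (\<Sum>i<N. \<Sum>j<N. c i * c j * w (x i - x j))"
    by (simp add: sum_distrib_left mult_ac)
  finally have "0 < ((2 * sqrt pi) ^ DIM('a) * sqrt pi ^ DIM('a)) * (\<Sum>i<N. \<Sum>j<N. c i * c j * w (x i - x j))"
    using q0 by simp
  moreover have "0 < (2 * sqrt pi) ^ DIM('a) * sqrt pi ^ DIM('a)"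
    by (intro mult_pos_pos zero_less_power) auto
  ultimately show ?thesis by (rule zero_less_mult_pos)
qed

section \<open>Monotonicity, finiteness and continuity of \<open>W\<close>\<close>

text \<open>Here \<open>a\<close> stands for the squared norm and \<open>t = a + v\<close>. From
  \<open>1 - a / (a + v) = v / (a + v)\<close> the power \<open>l\<close> splits into
  \<open>v powr l\<close> and \<open>(a + v) powr (-l)\<close>. For \<open>l < 0\<close> the
  singularity at \<open>t = a\<close> thus moves to \<open>v = 0\<close> for every \<open>a\<close>,
  which makes one common majorant possible.\<close>

definition W_kernel :: "real \<Rightarrow> real \<Rightarrow> real \<Rightarrow> real \<Rightarrow> real \<Rightarrow> real" where
  "W_kernel l \<alpha> \<rho> a v = v powr l * (a + v) powr (\<alpha> - l) * pos_powr (1 - (a + v) powr (1/2)) \<rho> * indicator {0<..} v"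

lemma measurable_W_kernel [measurable]: "W_kernel l \<alpha> \<rho> a \<in> borel_measurable borel"
  unfolding W_kernel_def[abs_def] by measurable

lemma W_kernel_nonneg: "0 \<le> W_kernel l \<alpha> \<rho> a v"
  by (simp add: W_kernel_def)

text \<open>Substituting \<open>t = \<parallel>x\<parallel>\<^sup>2 + v\<close> makes the integrand decreasing in \<open>\<parallel>x\<parallel>\<close> when \<open>\<alpha> \<le> l\<close>.\<close>

lemma W_eq_kernel: "W l \<alpha> \<rho> x = (\<integral>\<^sup>+v. ennreal (W_kernel l \<alpha> \<rho> ((norm x)\<^sup>2) v) \<partial>lborel)"
proof -
  define a where "a = (norm x)\<^sup>2"
  have a: "0 \<le> a" by (simp add: a_def)
  have "W l \<alpha> \<rho> x = ennreal \<bar>1\<bar> * (\<integral>\<^sup>+v. ennreal (pos_powr (1 - a / (a + 1 * v)) l * (a + 1 * v) powr \<alpha> *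
      pos_powr (1 - (a + 1 * v) powr (1/2)) \<rho>) * indicator {0<..} (a + 1 * v) \<partial>lborel)"
    unfolding W_def a_def[symmetric] by (rule nn_integral_real_affine) auto
  also have "\<dots> = (\<integral>\<^sup>+v. ennreal (W_kernel l \<alpha> \<rho> a v) \<partial>lborel)"
  proof (simp, intro nn_integral_cong)
    fix v :: real
    show "ennreal (pos_powr (1 - a / (a + v)) l * (a + v) powr \<alpha> * pos_powr (1 - (a + v) powr (1/2)) \<rho>)
      * indicator {0<..} (a + v) = ennreal (W_kernel l \<alpha> \<rho> a v)"
    proof (cases "0 < a + v")
      case True
      then have "1 - a / (a + v) = v / (a + v)" by (simp add: field_simps)
      then show ?thesis using True
        by (auto simp: W_kernel_def pos_powr_def zero_less_divide_iff powr_divide powr_diff mult_ac)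
    next
      case False
      then show ?thesis using a by (simp add: W_kernel_def)
    qed
  qed
  finally show ?thesis by (simp add: a_def)
qed

lemma W_kernel_antimono:
  assumes "0 \<le> a" "a \<le> b" "\<alpha> \<le> l" "0 \<le> \<rho>"
  shows "W_kernel l \<alpha> \<rho> b v \<le> W_kernel l \<alpha> \<rho> a v"
proof (cases "0 < v")
  case True
  have "(b + v) powr (\<alpha> - l) \<le> (a + v) powr (\<alpha> - l)"
    using assms True by (intro powr_mono2') auto
  moreover have "(a + v) powr (1/2) \<le> (b + v) powr (1/2)"
    using assms True by (intro powr_mono2) auto
  then have "pos_powr (1 - (b + v) powr (1/2)) \<rho> \<le> pos_powr (1 - (a + v) powr (1/2)) \<rho>"
    using assms by (auto simp: pos_powr_def intro!: powr_mono2)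
  ultimately show ?thesis unfolding W_kernel_def using True by (intro mult_mono mult_nonneg_nonneg) auto
qed (simp add: W_kernel_def)

lemma continuous_on_pos_powr:
  assumes "continuous_on A f" "0 < p" shows "continuous_on A (\<lambda>x. pos_powr (f x) p)"
proof -
  have "continuous_on A (\<lambda>x. max 0 (f x) powr p)"
    using assms by (intro continuous_on_powr' continuous_intros) auto
  moreover have "max 0 (f x) powr p = pos_powr (f x) p" for x
    using assms by (auto simp: pos_powr_def max_def)
  ultimately show ?thesis by simp
qed

text \<open>For \<open>v > 0\<close> the base \<open>a + v\<close> stays positive, and
  \<open>\<rho> > 0\<close> makes the truncated power continuous where \<open>a + v\<close> passes
  1; for other \<open>v\<close> the kernel is constantly 0.\<close>

lemma continuous_on_W_kernel:
  assumes "0 < \<rho>"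
  shows "continuous_on {0..} (\<lambda>a. W_kernel l \<alpha> \<rho> a v)"
  unfolding W_kernel_def using assms
  by (cases "0 < v") (auto intro!: continuous_intros continuous_on_pos_powr)

text \<open>Away from the origin \<open>(a + v) powr (\<alpha> - l)\<close> is at most
  \<open>a powr (\<alpha> - l)\<close>, and the kernel vanishes for \<open>v > 1\<close>. This
  leaves \<open>v powr l\<close> on \<open>[0, 1]\<close>, integrable because
  \<open>l > -1\<close>.\<close>

lemma W_finite:
  assumes l: "-1 < l" and \<alpha>: "\<alpha> \<le> l" and \<rho>: "0 \<le> \<rho>" and x: "x \<noteq> 0"
  shows "W l \<alpha> \<rho> x < \<infinity>"
proof -
  define a where "a = (norm x)\<^sup>2"
  have a: "0 < a" using x by (simp add: a_def)
  have "((\<lambda>v::real. v powr l) has_integral (1 powr (l + 1) / (l + 1))) {0..1}"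
    using has_integral_powr_from_0[of l 1] l by simp
  then have i: "(\<integral>\<^sup>+v. ennreal (indicator {0..1} v * v powr l) \<partial>lborel) = ennreal (1 powr (l + 1) / (l + 1))"
    by (intro nn_integral_has_integral_lebesgue) auto
  have "W l \<alpha> \<rho> x \<le> (\<integral>\<^sup>+v. ennreal (a powr (\<alpha> - l)) * ennreal (indicator {0..1} v * v powr l) \<partial>lborel)"
    unfolding W_eq_kernel a_def[symmetric]
  proof (rule nn_integral_mono)
    fix v :: real
    have "W_kernel l \<alpha> \<rho> a v \<le> a powr (\<alpha> - l) * (indicator {0..1} v * v powr l)"
    proof (cases "0 < v \<and> v \<le> 1")
      case True
      have "pos_powr (1 - (a + v) powr (1/2)) \<rho> \<le> 1"
        using \<rho> powr_mono2[of \<rho> "1 - (a + v) powr (1/2)" 1] by (auto simp: pos_powr_def)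
      moreover have "(a + v) powr (\<alpha> - l) \<le> a powr (\<alpha> - l)"
        using a \<alpha> True by (intro powr_mono2') auto
      ultimately have "(a + v) powr (\<alpha> - l) * pos_powr (1 - (a + v) powr (1/2)) \<rho> \<le> a powr (\<alpha> - l) * 1"
        by (intro mult_mono) auto
      then have "v powr l * ((a + v) powr (\<alpha> - l) * pos_powr (1 - (a + v) powr (1/2)) \<rho>) \<le> v powr l * a powr (\<alpha> - l)"
        by (intro mult_left_mono) auto
      then show ?thesis using True by (simp add: W_kernel_def mult_ac)
    next
      case False
      have "W_kernel l \<alpha> \<rho> a v = 0"
      proof (cases "0 < v")
        case True
        then have "1 \<le> (a + v) powr (1/2)" using False a by (intro ge_one_powr_ge_zero) auto
        then show ?thesis by (simp add: W_kernel_def pos_powr_def)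
      qed (simp add: W_kernel_def)
      then show ?thesis by simp
    qed
    then show "ennreal (W_kernel l \<alpha> \<rho> a v) \<le> ennreal (a powr (\<alpha> - l)) * ennreal (indicator {0..1} v * v powr l)"
      by (subst ennreal_mult[symmetric]) (auto intro!: ennreal_leI)
  qed
  also have "\<dots> = ennreal (a powr (\<alpha> - l)) * ennreal (1 powr (l + 1) / (l + 1))"
    by (subst nn_integral_cmult) (auto simp: i)
  also have "\<dots> < \<infinity>" by (simp add: ennreal_mult_less_top)
  finally show ?thesis .
qed

text \<open>The kernel at \<open>a = 0\<close> dominates all the others, and it is integrable
  because \<open>\<alpha> > -1\<close> makes \<open>W\<close> finite at the origin. This gives the
  bound directly and continuity by dominated convergence.\<close>

lemma W_bounded_continuous:
  assumes \<alpha>: "-1 < \<alpha>" "\<alpha> \<le> l" and \<rho>: "0 < \<rho>"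
  shows "W l \<alpha> \<rho> (x::'a::euclidean_space) < \<infinity>"
    and "enn2real (W l \<alpha> \<rho> x) \<le> enn2real (W l \<alpha> \<rho> (0::'a))"
    and "continuous_on UNIV (\<lambda>x::'a. enn2real (W l \<alpha> \<rho> x))"
proof -
  have fin0: "W l \<alpha> \<rho> (0::'a) < \<infinity>" using \<alpha> \<rho> by (intro W_zero_finite) auto
  have le: "W_kernel l \<alpha> \<rho> ((norm x)\<^sup>2) v \<le> W_kernel l \<alpha> \<rho> 0 v" for x :: 'a and v
    using \<alpha> \<rho> by (intro W_kernel_antimono) auto
  have le0: "W l \<alpha> \<rho> x \<le> W l \<alpha> \<rho> (0::'a)" for x :: 'a
    unfolding W_eq_kernel using le by (intro nn_integral_mono ennreal_leI) simp
  then show fin: "W l \<alpha> \<rho> x < \<infinity>" for x :: 'a using fin0 by (rule le_less_trans)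
  show "enn2real (W l \<alpha> \<rho> x) \<le> enn2real (W l \<alpha> \<rho> (0::'a))"
    using le0 fin0 by (intro enn2real_mono) auto
  have i0: "integrable lborel (W_kernel l \<alpha> \<rho> 0)"
    using fin0 W_kernel_nonneg by (intro integrableI_nonneg) (auto simp: W_eq_kernel)
  have wi: "enn2real (W l \<alpha> \<rho> x) = (\<integral>v. W_kernel l \<alpha> \<rho> ((norm x)\<^sup>2) v \<partial>lborel)" for x :: 'a
    unfolding W_eq_kernel using W_kernel_nonneg by (intro integral_eq_nn_integral[symmetric]) auto
  show "continuous_on UNIV (\<lambda>x::'a. enn2real (W l \<alpha> \<rho> x))"
    unfolding wi continuous_on_sequentially
  proof (intro allI ballI impI, elim conjE)
    fix u :: "nat \<Rightarrow> 'a" and z :: 'a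
    assume u: "u \<longlonglongrightarrow> z"
    show "((\<lambda>x. \<integral>v. W_kernel l \<alpha> \<rho> ((norm x)\<^sup>2) v \<partial>lborel) \<circ> u) \<longlonglongrightarrow> (\<integral>v. W_kernel l \<alpha> \<rho> ((norm z)\<^sup>2) v \<partial>lborel)"
      unfolding comp_def
    proof (rule integral_dominated_convergence[OF _ _ i0])
      show "AE v in lborel. (\<lambda>k. W_kernel l \<alpha> \<rho> ((norm (u k))\<^sup>2) v) \<longlonglongrightarrow> W_kernel l \<alpha> \<rho> ((norm z)\<^sup>2) v"
        by (intro AE_I2 continuous_on_tendsto_compose[OF continuous_on_W_kernel[OF \<rho>]] tendsto_intros u) auto
      show "AE v in lborel. norm (W_kernel l \<alpha> \<rho> ((norm (u k))\<^sup>2) v) \<le> W_kernel l \<alpha> \<rho> 0 v" for k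
        using le W_kernel_nonneg by (intro AE_I2) simp
    qed measurable
  qed
qed

lemma induces_positive_definite_W:
  assumes l: "-1 < l" and \<alpha>: "\<alpha> \<le> l" and \<rho>: "0 < \<rho>"
    and int: "integrable lborel (\<lambda>x::'a::euclidean_space. enn2real (W l \<alpha> \<rho> x))"
    and pos: "\<And>\<xi>::'a. 0 < (\<integral>x. enn2real (W l \<alpha> \<rho> x) * cos (\<xi> \<bullet> x) \<partial>lborel)"
  shows "induces_positive_definite (W l \<alpha> \<rho> :: 'a \<Rightarrow> ennreal)"
  unfolding induces_positive_definite_def positive_definite_def
proof (intro allI impI conjI)
  fix N :: nat and x :: "nat \<Rightarrow> 'a" and i j
  assume x: "inj_on x {..<N}" and ij: "i < N" "j < N"
  show "enn2ereal (W l \<alpha> \<rho> (x i - x j)) = enn2ereal (W l \<alpha> \<rho> (x j - x i))"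
    using W_uminus[of l \<alpha> \<rho> "x i - x j"] by simp
  show "enn2ereal (W l \<alpha> \<rho> (x i - x j)) \<noteq> - \<infinity>"
    using enn2ereal_nonneg[of "W l \<alpha> \<rho> (x i - x j)"] by auto
  assume "i \<noteq> j"
  then have "x i - x j \<noteq> 0" using x ij by (auto simp: inj_on_def)
  then show "enn2ereal (W l \<alpha> \<rho> (x i - x j)) \<noteq> \<infinity>"
    using W_finite[OF l \<alpha>, of \<rho> "x i - x j"] \<rho> by (simp add: enn2ereal_eq_top_iff less_top)
next
  fix N :: nat and x :: "nat \<Rightarrow> 'a" and c :: "nat \<Rightarrow> real"
  assume x: "inj_on x {..<N}" and c: "\<exists>i<N. c i \<noteq> 0"
  show "0 < (\<Sum>i<N. \<Sum>j<N. ereal (c i * c j) * enn2ereal (W l \<alpha> \<rho> (x i - x j)))"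
  proof (cases "-1 < \<alpha>")
    case True
    have "0 < (\<Sum>i<N. \<Sum>j<N. c i * c j * enn2real (W l \<alpha> \<rho> (x i - x j)))"
      using W_bounded_continuous(2,3)[OF True \<alpha> \<rho>]
      by (intro cos_transform_pos_imp_positive_definite[OF int _ _ _ pos x c]) (auto simp: W_uminus)
    moreover have "enn2ereal (W l \<alpha> \<rho> z) = ereal (enn2real (W l \<alpha> \<rho> z))" for z :: 'a
      using W_bounded_continuous(1)[OF True \<alpha> \<rho>, of z]
      by (cases "W l \<alpha> \<rho> z") (auto simp: enn2ereal_ennreal)
    ultimately show ?thesis by simp
  next
    case False
    then have top: "W l \<alpha> \<rho> (0::'a) = \<infinity>" using \<rho> by (intro W_zero_infinite) auto
    obtain i where i: "i < N" "c i \<noteq> 0" using c by auto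
    \<comment> \<open>A nonzero \<open>c i\<close> turns its infinite diagonal entry into a summand
      \<open>\<infinity>\<close>. Off-diagonal entries are finite and diagonal terms are never
      negative, so the whole form is \<open>\<infinity>\<close>.\<close>
    have "ereal (c i * c i) * enn2ereal (W l \<alpha> \<rho> (x i - x i)) = \<infinity>"
      using i by (auto simp: top zero_less_mult_iff linorder_neq_iff)
    then have "(\<Sum>j<N. ereal (c i * c j) * enn2ereal (W l \<alpha> \<rho> (x i - x j))) = \<infinity>"
      using i by (subst sum_Pinfty) auto
    then have "(\<Sum>i<N. \<Sum>j<N. ereal (c i * c j) * enn2ereal (W l \<alpha> \<rho> (x i - x j))) = \<infinity>"
      using i by (subst sum_Pinfty) auto
    then show ?thesis by simp
  qed
qed

theorem theorem5p2:
  fixes \<rho> l \<alpha> :: real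
  assumes "\<rho> \<ge> 1"
    and "(l, \<alpha>) \<in> admissible CARD('n::finite) \<rho>"
  shows "(\<forall>\<xi> :: real ^ 'n. \<exists>r > 0.
            fourier (\<lambda>x :: real ^ 'n. enn2real (W l \<alpha> \<rho> x)) \<xi> = complex_of_real r) \<and>
         induces_positive_definite (W l \<alpha> \<rho> :: real ^ 'n \<Rightarrow> ennreal)"
proof -
  have dim: "DIM(real ^ 'n) = CARD('n)" by simp
  have adm: "-1 < l" "- (real DIM(real ^ 'n) + 2) / 2 < \<alpha>" "\<alpha> \<le> l"
    "4 * \<alpha> \<le> 3 * l - (real DIM(real ^ 'n) + 3) / 2 + \<rho>" "2 * \<alpha> \<le> l - (real DIM(real ^ 'n) + 1) / 2 + \<rho>"
    using assms(2) unfolding dim admissible_def by auto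
  note ct = cos_transform_W[OF adm(1,2) assms(1) adm(3-5)]
  show ?thesis
  proof (intro conjI allI)
    fix \<xi> :: "real ^ 'n"
    have "fourier (\<lambda>x :: real ^ 'n. enn2real (W l \<alpha> \<rho> x)) \<xi> = complex_of_real (\<integral>x. enn2real (W l \<alpha> \<rho> x) * cos (\<xi> \<bullet> x) \<partial>lborel)"
      by (rule fourier_even[OF ct(1)]) (simp add: W_uminus)
    with ct(2)[of \<xi>] show "\<exists>r > 0. fourier (\<lambda>x :: real ^ 'n. enn2real (W l \<alpha> \<rho> x)) \<xi> = complex_of_real r" by blast
  next
    show "induces_positive_definite (W l \<alpha> \<rho> :: real ^ 'n \<Rightarrow> ennreal)"
      using assms(1) by (intro induces_positive_definite_W adm(1,3) ct) auto
  qed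
qed

end
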